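(* Assume (Amax), (Amin) and (Aint). For each $n$ let $\hat\theta_n$ be a maximizer over $\Theta$ of $\theta\mapsto\frac1n\ell_n(\theta)$. Then there exists $M>0$ such that $\mathbb P^*$-almost surely there exists $n_{\mathrm{loc}}\in\mathbb N$ with $\hat\theta_n\in\Theta^{OK}_n(M)$ for all $n\ge n_{\mathrm{loc}}$.
   Context: Setting. Fix integers $K\ge1$, $d\ge1$ and $\sigma_-\in(0,1)$. For $K'\in\mathbb N^*$, $[K']=\{1,\dots,K'\}$, $\Delta_{K'}$ is the set of probability vectors on $[K']$ and $\Sigma^{\sigma_-}_{K'}$ is the set of $K'\times K'$ stochastic matrices all of whose entries are $\ge\sigma_-$. $\mathbb R_d[X]$ is the set of real polynomials of degree at most $d$, viewed as functions on $\mathbb R_+$. $\Gamma$ is a set of probability densities on $\mathbb R$ (w.r.t. Lebesgue measure), endowed with the topology of pointwise convergence and assumed compact. The model is $\Theta=\bigcup_{K'=1}^K\{[K']\}\times\Delta_{K'}\times\Sigma^{\sigma_-}_{K'}\times\Gamma^{K'}\times(\mathbb R_d[X])^{K'}$, with elements $\theta=(K^\theta,\pi^\theta,Q^\theta,\gamma^\theta,T^\theta)$. Under $\theta$, $(X_t)_{t\ge1}$ is a Markov chain on $[K^\theta]$ with initial law $\pi^\theta$ and transition matrix $Q^\theta$, and conditionally on $(X_t)_t$ the $Y_t$ are independent, $Y_t$ having density $y\mapsto\gamma^\theta_{X_t}(y-T^\theta_{X_t}(t))$; $\ell_n(\theta)=\log\sum_{x_1^n\in[K^\theta]^n}\pi^\theta(x_1)\prod_{t=2}^nQ^\theta(x_{t-1},x_t)\prod_{t=1}^n\gamma^\theta_{x_t}(Y_t-T^\theta_{x_t}(t))$.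 True parameter: $\theta^*=(K^*,\pi^*,Q^*,\gamma^*,T^* )\in\Theta$. Data: under $\mathbb P^*$ (expectation $\mathbb E^*$), $(X_t)_{t\ge1}$ is a Markov chain on $[K^*]$ with $(\pi^*,Q^* )$; for each $x\in[K^*]$, $(Z^x_t)_{t\ge1}$ is i.i.d. with density $\gamma^*_x$, these sequences being mutually independent and independent of $(X_t)$; $Z_t=Z^{X_t}_t$, $Z^{\max}_t=\max_x|Z^x_t|$, $Y_t=Z_t+T^*_{X_t}(t)$. Assumptions. (Amax): there is a nonincreasing $g:\mathbb R_+\to\mathbb R_+$ with $g(z)\to0$ as $z\to\infty$ and $\gamma(z)\le g(|z|)$ for all $\gamma\in\Gamma$, $z$. (Amin): there is a nonincreasing $m:\mathbb R_+\to\mathbb R_+$ with $\gamma(z)\ge m(|z|)>0$ for all $\gamma\in\Gamma$, $z$. (Aint): for every $M>0$, $\mathbb E^*|\log m(M+Z^{\max}_1)|<\infty$. With $\|f\|_{\infty,[0,n]}=\sup_{t\in[0,n]}|f(t)|$, $\Theta^{OK}_n(M)$ is the set of $\theta\in\Theta$ such that every $x^*\in[K^*]$ has some $x\in[K^\theta]$ with $\|T^*_{x^*}-T^\theta_x\|_{\infty,[0,n]}\le M$, and every $x\in[K^\theta]$ has some $x^*\in[K^*]$ with $\|T^*_{x^*}-T^\theta_x\|_{\infty,[0,n]}\le M$. *)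

theory Defs
  imports "HOL-Probability.Probability" "HOL-Computational_Algebra.Polynomial"
begin

text \<open>A parameter theta = (K, pi, Q, gamma, T). Hidden states are 1..K.
  Components outside the index range 1..K are irrelevant.\<close>
record hmm_param =
  Kp  :: nat
  pip :: "nat \<Rightarrow> real"
  Qp  :: "nat \<Rightarrow> nat \<Rightarrow> real"
  gam :: "nat \<Rightarrow> real \<Rightarrow> real"
  Tp  :: "nat \<Rightarrow> real poly"

definition prob_vec :: "nat \<Rightarrow> (nat \<Rightarrow> real) \<Rightarrow> bool" where
  "prob_vec K' p \<longleftrightarrow> (\<forall>i\<in>{1..K'}. 0 \<le> p i) \<and> (\<Sum>i\<in>{1..K'}. p i) = 1"

definition stoch_mat_lb :: "real \<Rightarrow> nat \<Rightarrow> (nat \<Rightarrow> nat \<Rightarrow> real) \<Rightarrow> bool" where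
  "stoch_mat_lb \<sigma> K' Q \<longleftrightarrow>
     (\<forall>i\<in>{1..K'}. \<forall>j\<in>{1..K'}. \<sigma> \<le> Q i j) \<and> (\<forall>i\<in>{1..K'}. (\<Sum>j\<in>{1..K'}. Q i j) = 1)"

definition is_density :: "(real \<Rightarrow> real) \<Rightarrow> bool" where
  "is_density f \<longleftrightarrow> f \<in> borel_measurable borel \<and> (\<forall>z. 0 \<le> f z)
      \<and> (\<integral>\<^sup>+ z. ennreal (f z) \<partial>lborel) = 1"

definition Theta :: "nat \<Rightarrow> nat \<Rightarrow> real \<Rightarrow> (real \<Rightarrow> real) set \<Rightarrow> hmm_param set" where
  "Theta K d \<sigma> \<Gamma> = {\<theta>. 1 \<le> Kp \<theta> \<and> Kp \<theta> \<le> K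
      \<and> prob_vec (Kp \<theta>) (pip \<theta>)
      \<and> stoch_mat_lb \<sigma> (Kp \<theta>) (Qp \<theta>)
      \<and> (\<forall>x\<in>{1..Kp \<theta>}. gam \<theta> x \<in> \<Gamma>)
      \<and> (\<forall>x\<in>{1..Kp \<theta>}. degree (Tp \<theta> x) \<le> d)}"

definition loglik :: "hmm_param \<Rightarrow> nat \<Rightarrow> (nat \<Rightarrow> real) \<Rightarrow> real" where
  "loglik \<theta> n y = ln (\<Sum>xs \<in> PiE {1..n} (\<lambda>_. {1..Kp \<theta>}).
      pip \<theta> (xs 1) * (\<Prod>t\<in>{2..n}. Qp \<theta> (xs (t - 1)) (xs t))
      * (\<Prod>t\<in>{1..n}. gam \<theta> (xs t) (y t - poly (Tp \<theta> (xs t)) (real t))))"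

definition sup_norm_on :: "nat \<Rightarrow> (real \<Rightarrow> real) \<Rightarrow> real" where
  "sup_norm_on n f = Sup ((\<lambda>s. \<bar>f s\<bar>) ` {0..real n})"

text \<open>Theta^OK_n(M), relative to the true trend polynomials Ts on [Ks].\<close>
definition Theta_OK :: "nat \<Rightarrow> (nat \<Rightarrow> real poly) \<Rightarrow> nat \<Rightarrow> real \<Rightarrow> hmm_param set \<Rightarrow> hmm_param set" where
  "Theta_OK Ks Ts n M Th = {\<theta> \<in> Th.
      (\<forall>xs\<in>{1..Ks}. \<exists>x\<in>{1..Kp \<theta>}. sup_norm_on n (\<lambda>s. poly (Ts xs) s - poly (Tp \<theta> x) s) \<le> M)
    \<and> (\<forall>x\<in>{1..Kp \<theta>}. \<exists>xs\<in>{1..Ks}. sup_norm_on n (\<lambda>s. poly (Ts xs) s - poly (Tp \<theta> x) s) \<le> M)}"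

end

theory Submission
  imports Defs "HOL-Real_Asymp.Real_Asymp"
begin

text \<open>A polynomial of degree at most \<open>d\<close> that is at most \<open>D\<close> in absolute value on a positive fraction
  of \<open>{1..n}\<close> is at most \<open>C D\<close> on \<open>[0, n]\<close>, uniformly in \<open>n\<close>. So a trend that is far from a true
  trend in sup norm is far from it at almost all times.

  Every true component is approximated: the log-likelihood at the true parameter is at least \<open>-C n\<close>
  by a law of large numbers, whereas if all trends of \<open>\<theta>\<close> are far from that of \<open>x*\<close>, every emission
  density is tiny at the linearly many times when the hidden state is \<open>x*\<close> and the noise is moderate.

  Every estimated component is useful: a component far from all true trends contributes almost
  nothing, yet each transition loses probability at least \<open>\<sigma>\<close> to it. Deleting it and renormalizing
  the transition matrix gains a factor \<open>(1 - \<sigma>) ^ (1 - n)\<close>, which outweighs the loss from rerouting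
  the paths that visit it, so the parameter was not a maximizer.\<close>

section \<open>Polynomials small on a dense set of integers\<close>

text \<open>Randomness enters the estimates through visit counts and through sums of nonnegative
  functions of the noise of a single component; candidate trends enter through deterministic sets of
  times. Hence one null set and one threshold on \<open>n\<close> serve all of
  \<open>Theta K d \<sigma> \<Gamma>\<close>. Only upper bounds on such sums are needed, with
  constants still free, so a law of large numbers that loses a factor 2 is enough. A far component
  cannot be excluded by bounding the likelihood from above: the other components may explain the
  data, and then nothing forces it below \<open>exp (- C n)\<close>. This is why a competitor is
  built, which lies in the model because fewer states are allowed. Its gain of
  \<open>- ln (1 - \<sigma>)\<close> per transition is spent in quarters: on ordinary times, on
  times when the far trend is near a true one, on times of large noise, and on the terms that do not
  grow with \<open>n\<close>. Covering the true components must come first, since a visit to the far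
  component is rerouted through the component close to the trend of the true hidden state.\<close>

text \<open>Induction on the degree by splitting off a linear factor at a point \<open>u\<close> of
  \<open>T\<close>: \<open>p x = p u + (x - u) * q x\<close>. Away from \<open>u\<close> the
  division gains a factor of order \<open>1 / n\<close>, and multiplying back by
  \<open>x - u\<close> on \<open>[0, n]\<close> loses at most \<open>n\<close>, so the constant does
  not depend on \<open>n\<close>.\<close>

lemma poly_bound_from_dense_set:
  "\<delta> > 0 \<Longrightarrow> \<exists>C n0. C \<ge> 1 \<and> (\<forall>n\<ge>n0. \<forall>(p :: real poly) D T. degree p \<le> d \<longrightarrow> T \<subseteq> {1..n} \<longrightarrow> \<delta> * real n \<le> real (card T)
     \<longrightarrow> (\<forall>t\<in>T. \<bar>poly p (real t)\<bar> \<le> D) \<longrightarrow> (\<forall>s\<in>{0..real n}. \<bar>poly p s\<bar> \<le> C * D))"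
proof (induction d arbitrary: \<delta>)
  case 0
  show ?case
  proof (intro exI[of _ 1] conjI allI impI ballI)
    fix n :: nat and p :: "real poly" and D T s
    assume H: "1 \<le> n" "degree p \<le> 0" "T \<subseteq> {1..n}" "\<delta> * real n \<le> real (card T)"
      "\<forall>t\<in>T. \<bar>poly p (real t)\<bar> \<le> D"
    have "0 < \<delta> * real n" using H 0 by simp
    with H have "card T > 0" by linarith
    then obtain t where t: "t \<in> T" by (metis card_gt_0_iff ex_in_conv)
    obtain a where "p = [:a:]" using H(2) degree_eq_zeroE by blast
    with H(5) t show "\<bar>poly p s\<bar> \<le> 1 * D" by auto
  qed simp
next
  case (Suc d)
  then obtain C n0 where C: "C \<ge> 1" and IH: "\<And>n (p :: real poly) D T s. n \<ge> n0 \<Longrightarrow> degree p \<le> d \<Longrightarrow> T \<subseteq> {1..n}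
      \<Longrightarrow> \<delta> / 4 * real n \<le> real (card T) \<Longrightarrow> (\<forall>t\<in>T. \<bar>poly p (real t)\<bar> \<le> D) \<Longrightarrow> s \<in> {0..real n}
      \<Longrightarrow> \<bar>poly p s\<bar> \<le> C * D"
    using Suc.IH[of "\<delta> / 4"] Suc.prems by (metis zero_less_divide_iff zero_less_numeral)
  \<comment> \<open>Beyond \<open>n1\<close> the radius \<open>h\<close> used below is at least
    1.\<close>
  define n1 where "n1 = max (max n0 1) (nat \<lceil>4 / \<delta>\<rceil>)"
  show ?case
  proof (intro exI[of _ "1 + 8 * C / \<delta>"] exI[of _ n1] conjI allI impI ballI)
    show "1 \<le> 1 + 8 * C / \<delta>" using C Suc.prems by simp
  next
    fix n :: nat and p :: "real poly" and D T s
    assume H: "n1 \<le> n" "degree p \<le> Suc d" "T \<subseteq> {1..n}" "\<delta> * real n \<le> real (card T)"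
      "\<forall>t\<in>T. \<bar>poly p (real t)\<bar> \<le> D" and s: "s \<in> {0..real n}"
    have n: "n \<ge> n0" "n \<ge> 1" "4 / \<delta> \<le> real n" using H(1) unfolding n1_def by linarith+
    have n\<delta>: "4 \<le> \<delta> * real n" using n(3) Suc.prems by (simp add: field_simps)
    have fin: "finite T" using H(3) finite_subset by blast
    from H(4) n\<delta> have "card T > 0" by linarith
    then obtain u where u: "u \<in> T" by (metis card_gt_0_iff ex_in_conv)
    have D: "0 \<le> D" using H(5) u by force
    define q where "q = synthetic_div p (real u)"
    have eq: "poly p x = poly p (real u) + (x - real u) * poly q x" for x
      using arg_cong[OF synthetic_div_correct'[of "real u" p], of "\<lambda>p. poly p x"]
      by (simp add: q_def algebra_simps)
    \<comment> \<open>\<open>T\<close> has at least \<open>4 * h\<close> points, of which at most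
      \<open>2 * h + 1 \<le> 3 * h\<close> lie within \<open>h\<close> of \<open>u\<close>. The
      remaining \<open>h\<close> points are the fraction \<open>\<delta> / 4\<close> at which the
      induction hypothesis is taken.\<close>
    define h where "h = \<delta> * real n / 4"
    have h: "h \<ge> 1" using n\<delta> by (simp add: h_def)
    define N where "N = {t\<in>T. \<bar>real t - real u\<bar> < h}"
    have "N \<subseteq> {u - nat \<lfloor>h\<rfloor> .. u + nat \<lfloor>h\<rfloor>}"
      unfolding N_def by (auto simp: abs_less_iff) linarith+
    then have "card N \<le> card {u - nat \<lfloor>h\<rfloor> .. u + nat \<lfloor>h\<rfloor>}" by (intro card_mono) auto
    also have "\<dots> \<le> 2 * nat \<lfloor>h\<rfloor> + 1" by auto
    finally have "real (card N) \<le> 2 * h + 1" using h by linarith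
    then have "real (card T) - real (card N) \<ge> 4 * h - 2 * h - 1" using H(4) by (simp add: h_def)
    moreover have "card (T - N) = card T - card N" "card N \<le> card T"
      using fin by (auto simp: N_def card_Diff_subset card_mono)
    ultimately have cardTN: "\<delta> / 4 * real n \<le> real (card (T - N))" using h by (simp add: h_def of_nat_diff)
    have qb: "\<bar>poly q (real t)\<bar> \<le> 2 * D / h" if "t \<in> T - N" for t
    proof -
      have "\<bar>real t - real u\<bar> * \<bar>poly q (real t)\<bar> = \<bar>poly p (real t) - poly p (real u)\<bar>"
        using eq[of "real t"] by (simp add: abs_mult[symmetric])
      also have "\<dots> \<le> D + D" using H(5) that u by (intro order_trans[OF abs_triangle_ineq4] add_mono) auto
      finally have "h * \<bar>poly q (real t)\<bar> \<le> 2 * D"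
        using that mult_right_mono[of h "\<bar>real t - real u\<bar>" "\<bar>poly q (real t)\<bar>"] by (auto simp: N_def)
      then show ?thesis using h by (simp add: field_simps)
    qed
    have "\<bar>poly q s\<bar> \<le> C * (2 * D / h)"
      by (rule IH[of n q "T - N"]) (use n H qb s cardTN in \<open>auto simp: q_def degree_synthetic_div\<close>)
    moreover have "\<bar>s - real u\<bar> \<le> real n" using s u H(3) by (auto simp: subset_iff abs_le_iff)
    ultimately have "\<bar>s - real u\<bar> * \<bar>poly q s\<bar> \<le> real n * (C * (2 * D / h))" by (intro mult_mono) auto
    also have "\<dots> = 8 * C / \<delta> * D" using n Suc.prems by (simp add: h_def field_simps)
    finally have "\<bar>poly p s\<bar> \<le> D + 8 * C / \<delta> * D"
      using H(5) u eq[of s] abs_triangle_ineq[of "poly p (real u)" "(s - real u) * poly q s"]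
      by (simp add: abs_mult) (smt (verit))
    then show "\<bar>poly p s\<bar> \<le> (1 + 8 * C / \<delta>) * D" by (simp add: algebra_simps)
  qed
qed

section \<open>Path sums and the forward recursion\<close>

text \<open>State set and emissions stay abstract, so that the same path sum covers likelihoods,
  total masses, exponential moments of visit counts and chains with a state removed.\<close>

definition lik :: "nat set \<Rightarrow> (nat \<Rightarrow> real) \<Rightarrow> (nat \<Rightarrow> nat \<Rightarrow> real) \<Rightarrow> (nat \<Rightarrow> nat \<Rightarrow> real) \<Rightarrow> nat \<Rightarrow> real" where
  "lik S p Q e n = (\<Sum>xs \<in> PiE {1..n} (\<lambda>_. S). p (xs 1) * (\<Prod>t\<in>{2..n}. Q (xs (t - 1)) (xs t))
      * (\<Prod>t\<in>{1..n}. e t (xs t)))"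

text \<open>The unnormalized forward filter. The argument \<open>n\<close> stands for time
  \<open>n + 1\<close>, so \<open>fwd\<close> at \<open>n\<close> belongs to paths of length
  \<open>Suc n\<close>.\<close>

fun fwd :: "nat set \<Rightarrow> (nat \<Rightarrow> real) \<Rightarrow> (nat \<Rightarrow> nat \<Rightarrow> real) \<Rightarrow> (nat \<Rightarrow> nat \<Rightarrow> real) \<Rightarrow> nat \<Rightarrow> nat \<Rightarrow> real" where
  "fwd S p Q e 0 j = p j * e 1 j"
| "fwd S p Q e (Suc n) j = (\<Sum>i\<in>S. fwd S p Q e n i * Q i j) * e (Suc (Suc n)) j"

lemma sum_PiE_Suc:
  "(\<Sum>xs \<in> PiE {1..Suc n} (\<lambda>_. S). F xs)
     = (\<Sum>xs \<in> PiE {1..n} (\<lambda>_. S). \<Sum>j\<in>S. F (xs(Suc n := j)))"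
proof -
  have eq: "{1..Suc n} = insert (Suc n) {1..n}" by auto
  have "(\<Sum>xs \<in> PiE {1..Suc n} (\<lambda>_. S). F xs)
      = (\<Sum>(j, xs) \<in> S \<times> PiE {1..n} (\<lambda>_. S). F (xs(Suc n := j)))"
    unfolding eq PiE_insert_eq
    by (subst sum.reindex) (auto intro!: inj_combinator sum.cong)
  also have "\<dots> = (\<Sum>j\<in>S. \<Sum>xs \<in> PiE {1..n} (\<lambda>_. S). F (xs(Suc n := j)))"
    by (simp add: sum.cartesian_product)
  also have "\<dots> = (\<Sum>xs \<in> PiE {1..n} (\<lambda>_. S). \<Sum>j\<in>S. F (xs(Suc n := j)))"
    by (rule sum.swap)
  finally show ?thesis .
qed

text \<open>The weight \<open>u\<close> on the final state lets the induction close: summing out the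
  last step turns \<open>u\<close> into another function of the state before it.\<close>

lemma path_sum_fwd:
  "(\<Sum>xs \<in> PiE {1..Suc n} (\<lambda>_. S). p (xs 1) * (\<Prod>t\<in>{2..Suc n}. Q (xs (t - 1)) (xs t))
      * (\<Prod>t\<in>{1..Suc n}. e t (xs t)) * u (xs (Suc n))) = (\<Sum>j\<in>S. fwd S p Q e n j * u j)"
proof (induction n arbitrary: u)
  case 0
  then show ?case by (subst sum_PiE_Suc) simp
next
  case (Suc n)
  let ?w = "\<lambda>n xs. p (xs 1) * (\<Prod>t\<in>{2..n}. Q (xs (t - 1)) (xs t)) * (\<Prod>t\<in>{1..n}. e t (xs t))"
  have w: "?w (Suc (Suc n)) (xs(Suc (Suc n) := j)) * u j
      = ?w (Suc n) xs * (Q (xs (Suc n)) j * e (Suc (Suc n)) j * u j)" for xs j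
  proof -
    have a: "{2..Suc (Suc n)} = insert (Suc (Suc n)) {2..Suc n}"
            "{1..Suc (Suc n)} = insert (Suc (Suc n)) {1..Suc n}" by auto
    have "(\<Prod>t\<in>{2..Suc n}. Q ((xs(Suc (Suc n) := j)) (t - 1)) ((xs(Suc (Suc n) := j)) t))
        = (\<Prod>t\<in>{2..Suc n}. Q (xs (t - 1)) (xs t))"
      "(\<Prod>t\<in>{1..Suc n}. e t ((xs(Suc (Suc n) := j)) t)) = (\<Prod>t\<in>{1..Suc n}. e t (xs t))"
      by (auto intro!: prod.cong)
    then show ?thesis unfolding a by simp
  qed
  have "(\<Sum>xs \<in> PiE {1..Suc (Suc n)} (\<lambda>_. S). ?w (Suc (Suc n)) xs * u (xs (Suc (Suc n))))
     = (\<Sum>xs \<in> PiE {1..Suc n} (\<lambda>_. S). ?w (Suc n) xs * (\<Sum>j\<in>S. Q (xs (Suc n)) j * e (Suc (Suc n)) j * u j))"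
    unfolding sum_PiE_Suc[of _ "Suc n"] sum_distrib_left
    by (intro sum.cong refl, subst w[symmetric]) simp
  also have "\<dots> = (\<Sum>i\<in>S. fwd S p Q e n i * (\<Sum>j\<in>S. Q i j * e (Suc (Suc n)) j * u j))"
    by (rule Suc.IH)
  also have "\<dots> = (\<Sum>j\<in>S. fwd S p Q e (Suc n) j * u j)"
    by (simp add: sum_distrib_left sum_distrib_right, subst sum.swap) (simp add: mult_ac)
  finally show ?case .
qed

lemma lik_fwd: "lik S p Q e (Suc n) = (\<Sum>j\<in>S. fwd S p Q e n j)"
  using path_sum_fwd[of p Q n e "\<lambda>_. 1" S] by (simp add: lik_def)

lemma fwd_nonneg:
  assumes "\<And>i. i \<in> S \<Longrightarrow> 0 \<le> p i" "\<And>i j. i \<in> S \<Longrightarrow> j \<in> S \<Longrightarrow> 0 \<le> Q i j"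
    "\<And>t j. j \<in> S \<Longrightarrow> 0 \<le> e t j" "j \<in> S"
  shows "0 \<le> fwd S p Q e n j"
  using assms(4)
  by (induction n arbitrary: j) (auto intro!: mult_nonneg_nonneg sum_nonneg assms(1-3))

text \<open>\<open>b t\<close> bounds the mean emission after one transition, whatever the previous
  state, so the last time can be summed out at the price of one factor. This serves both the
  Chernoff bound for visits and the upper bound on likelihoods.\<close>

lemma lik_le_prod:
  assumes "\<And>i. i \<in> S \<Longrightarrow> 0 \<le> p i" "\<And>i j. i \<in> S \<Longrightarrow> j \<in> S \<Longrightarrow> 0 \<le> Q i j"
    "\<And>t j. j \<in> S \<Longrightarrow> 0 \<le> e t j"
    and b0: "(\<Sum>j\<in>S. p j * e 1 j) \<le> b 1"
    and b: "\<And>t i. i \<in> S \<Longrightarrow> t \<in> {2..Suc n} \<Longrightarrow> (\<Sum>j\<in>S. Q i j * e t j) \<le> b t"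
    and b_nonneg: "\<And>t. 0 \<le> b t"
  shows "lik S p Q e (Suc n) \<le> (\<Prod>t\<in>{1..Suc n}. b t)"
  using b
proof (induction n)
  case 0
  then show ?case using b0 by (simp add: lik_fwd)
next
  case (Suc n)
  have IH: "lik S p Q e (Suc n) \<le> (\<Prod>t\<in>{1..Suc n}. b t)" by (rule Suc.IH) (use Suc.prems in auto)
  have "lik S p Q e (Suc (Suc n)) = (\<Sum>i\<in>S. fwd S p Q e n i * (\<Sum>j\<in>S. Q i j * e (Suc (Suc n)) j))"
    unfolding lik_fwd
    by (simp add: sum_distrib_left sum_distrib_right, subst sum.swap) (simp add: mult_ac)
  also have "\<dots> \<le> (\<Sum>i\<in>S. fwd S p Q e n i * b (Suc (Suc n)))"
    by (intro sum_mono mult_left_mono Suc.prems fwd_nonneg assms) auto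
  also have "\<dots> = lik S p Q e (Suc n) * b (Suc (Suc n))" by (simp add: lik_fwd sum_distrib_right)
  also have "\<dots> \<le> (\<Prod>t\<in>{1..Suc n}. b t) * b (Suc (Suc n))" by (intro mult_right_mono IH b_nonneg)
  finally show ?case by simp
qed

lemma fwd_ge_path:
  assumes "finite S" "\<And>i. i \<in> S \<Longrightarrow> 0 \<le> p i" "0 \<le> \<sigma>" "\<And>i j. i \<in> S \<Longrightarrow> j \<in> S \<Longrightarrow> \<sigma> \<le> Q i j"
    "\<And>t j. j \<in> S \<Longrightarrow> 0 \<le> e t j" and xs: "\<And>t. t \<in> {1..Suc n} \<Longrightarrow> xs t \<in> S"
  shows "p (xs 1) * \<sigma> ^ n * (\<Prod>t\<in>{1..Suc n}. e t (xs t)) \<le> fwd S p Q e n (xs (Suc n))"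
  using xs
proof (induction n)
  case (Suc n)
  have Q: "i \<in> S \<Longrightarrow> j \<in> S \<Longrightarrow> 0 \<le> Q i j" for i j using assms(3,4) by (meson order_trans)
  have S: "xs (Suc n) \<in> S" "xs (Suc (Suc n)) \<in> S" using Suc.prems by auto
  have "p (xs 1) * \<sigma> ^ Suc n * (\<Prod>t\<in>{1..Suc (Suc n)}. e t (xs t))
     = (p (xs 1) * \<sigma> ^ n * (\<Prod>t\<in>{1..Suc n}. e t (xs t))) * \<sigma> * e (Suc (Suc n)) (xs (Suc (Suc n)))"
    by simp
  also have "\<dots> \<le> fwd S p Q e n (xs (Suc n)) * Q (xs (Suc n)) (xs (Suc (Suc n))) * e (Suc (Suc n)) (xs (Suc (Suc n)))"
    by (intro mult_right_mono mult_mono Suc.IH assms(2-5) S fwd_nonneg Q) (use Suc.prems in auto)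
  also have "\<dots> \<le> fwd S p Q e (Suc n) (xs (Suc (Suc n)))"
    unfolding fwd.simps
    by (intro mult_right_mono assms S member_le_sum[of _ S "\<lambda>i. fwd S p Q e n i * Q i (xs (Suc (Suc n)))"]
        mult_nonneg_nonneg fwd_nonneg Q) auto
  finally show ?case .
qed simp

lemma lik_ge_path:
  assumes "finite S" "\<And>i. i \<in> S \<Longrightarrow> 0 \<le> p i" "0 \<le> \<sigma>" "\<And>i j. i \<in> S \<Longrightarrow> j \<in> S \<Longrightarrow> \<sigma> \<le> Q i j"
    "\<And>t j. j \<in> S \<Longrightarrow> 0 \<le> e t j" and xs: "\<And>t. t \<in> {1..Suc n} \<Longrightarrow> xs t \<in> S"
  shows "p (xs 1) * \<sigma> ^ n * (\<Prod>t\<in>{1..Suc n}. e t (xs t)) \<le> lik S p Q e (Suc n)"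
proof -
  have Q: "i \<in> S \<Longrightarrow> j \<in> S \<Longrightarrow> 0 \<le> Q i j" for i j using assms(3,4) by (meson order_trans)
  have "fwd S p Q e n (xs (Suc n)) \<le> lik S p Q e (Suc n)"
    unfolding lik_fwd by (intro member_le_sum fwd_nonneg assms Q) (auto intro: xs)
  with fwd_ge_path[of S p \<sigma> Q e n xs] assms show ?thesis by fastforce
qed

lemma fwd_reindex:
  assumes "bij_betw f S' S" "j \<in> S'"
  shows "fwd S' (p \<circ> f) (\<lambda>i j. Q (f i) (f j)) (\<lambda>t j. e t (f j)) n j = fwd S p Q e n (f j)"
  using assms(2)
proof (induction n arbitrary: j)
  case (Suc n)
  show ?case using Suc by (simp add: sum.reindex_bij_betw[OF assms(1), symmetric])
qed simp

text \<open>Parameters number their states from 1 without gaps; relabelling closes the gap left by a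
  deleted state.\<close>

lemma lik_reindex:
  assumes "bij_betw f S' S"
  shows "lik S' (p \<circ> f) (\<lambda>i j. Q (f i) (f j)) (\<lambda>t j. e t (f j)) (Suc n) = lik S p Q e (Suc n)"
  unfolding lik_fwd by (simp add: fwd_reindex[OF assms] sum.reindex_bij_betw[OF assms, symmetric])

text \<open>Invariant: the forward weights of the full chain are at most \<open>R n\<close> times those of the reduced
  chain, and the weight at \<open>x\<close> is at most \<open>R n * \<rho> (n + 1)\<close> times the one at the substitute state.\<close>

lemma lik_delete_state:
  fixes \<alpha> \<beta> C :: real and r :: "nat \<Rightarrow> real"
  assumes S: "finite S" "x \<in> S" "\<And>t. x' t \<in> S - {x}"
    and p: "\<And>i. i \<in> S \<Longrightarrow> 0 \<le> p i" "\<And>i. i \<in> S - {x} \<Longrightarrow> 0 \<le> p' i"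
           "\<And>i i'. i \<in> S \<Longrightarrow> i' \<in> S - {x} \<Longrightarrow> p i \<le> C * p' i'"
    and Q: "\<And>i j. i \<in> S \<Longrightarrow> j \<in> S \<Longrightarrow> 0 \<le> Q i j"
           "\<And>i j. i \<in> S - {x} \<Longrightarrow> j \<in> S - {x} \<Longrightarrow> 0 \<le> Q' i j"
           "\<And>i j. i \<in> S - {x} \<Longrightarrow> j \<in> S - {x} \<Longrightarrow> Q i j \<le> \<alpha> * Q' i j"
           "\<And>i j i' j'. i \<in> S \<Longrightarrow> j \<in> S \<Longrightarrow> i' \<in> S - {x} \<Longrightarrow> j' \<in> S - {x} \<Longrightarrow> Q i j \<le> \<beta> * Q' i' j'"
    and e: "\<And>t j. j \<in> S \<Longrightarrow> 0 \<le> e t j" "\<And>t. e t x \<le> r t * e t (x' t)"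
    and c: "0 < \<alpha>" "\<alpha> \<le> 1" "1 \<le> \<beta>" "0 \<le> C" "\<And>t. 0 \<le> r t"
  shows "lik S p Q e (Suc n)
     \<le> C * \<alpha> ^ n * (\<Prod>t\<in>{1..Suc n}. 1 + (\<beta> / \<alpha>)\<^sup>2 * r t) * lik (S - {x}) p' Q' e (Suc n)"
proof -
  let ?S = "S - {x}"
  \<comment> \<open>Rerouting a visit to \<open>x\<close> replaces two transitions. The way in costs
    \<open>\<beta>\<close> against the \<open>\<alpha>\<close> contained in \<open>R\<close>, which
    gives \<open>\<rho>\<close>; the way out costs another \<open>\<beta>\<close>. The visit at time
    \<open>n + 1\<close> is not yet in \<open>R n\<close>: it is charged when \<open>x\<close> is
    left, through \<open>RS\<close>, or at the end of the path.\<close>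
  define \<rho> where "\<rho> t = \<beta> * r t / \<alpha>" for t
  define R where "R n = C * \<alpha> ^ n * (\<Prod>t\<in>{1..n}. 1 + (\<beta> / \<alpha>)\<^sup>2 * r t)" for n
  let ?a = "fwd S p Q e" and ?b = "fwd ?S p' Q' e"
  have \<rho>0: "0 \<le> \<rho> t" for t using c by (simp add: \<rho>_def)
  have R0: "0 \<le> R n" for n unfolding R_def using c by (intro mult_nonneg_nonneg prod_nonneg) auto
  have RS: "R (Suc n) = R n * (\<alpha> + \<beta> * \<rho> (Suc n))" for n
    using c by (simp add: R_def \<rho>_def field_simps power2_eq_square)
  have b0: "j \<in> ?S \<Longrightarrow> 0 \<le> ?b n j" for n j
    by (rule fwd_nonneg) (use p Q e in auto)
  have sumS: "(\<Sum>i\<in>S. f i) = (\<Sum>i\<in>?S. f i) + f x" for f :: "nat \<Rightarrow> real"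
    using S by (simp add: sum.remove[of S x])
  have single: "?b n (x' t) * Q' (x' t) j \<le> (\<Sum>i\<in>?S. ?b n i * Q' i j)" if "j \<in> ?S" for n t j
    using S that b0 Q(2) by (intro member_le_sum[of "x' t" ?S "\<lambda>i. ?b n i * Q' i j"]) auto
  have main: "(\<forall>j\<in>?S. ?a n j \<le> R n * ?b n j) \<and> ?a n x \<le> R n * \<rho> (Suc n) * ?b n (x' (Suc n))" for n
  proof (induction n)
    case 0
    have 1: "p j * e 1 j \<le> C * p' j * e 1 j" if "j \<in> ?S" for j
      using p(3)[of j j] that e(1) by (intro mult_right_mono) auto
    have "p x * e 1 x \<le> C * p' (x' 1) * (r 1 * e 1 (x' 1))"
      using S p c e by (intro mult_mono) auto
    also have "\<dots> \<le> C * p' (x' 1) * (\<rho> 1 * e 1 (x' 1))"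
    proof (intro mult_left_mono mult_right_mono)
      have "r 1 * \<alpha> \<le> r 1 * \<beta>" using c by (intro mult_left_mono) auto
      then show "r 1 \<le> \<rho> 1" using c by (simp add: \<rho>_def field_simps)
    qed (use S e p c in auto)
    finally show ?case using 1 by (simp add: R_def mult_ac)
  next
    case (Suc n)
    have IH1: "?a n j \<le> R n * ?b n j" if "j \<in> ?S" for j using Suc.IH that by blast
    have IH2: "?a n x \<le> R n * \<rho> (Suc n) * ?b n (x' (Suc n))" using Suc.IH by blast
    let ?x1 = "x' (Suc n)" and ?x2 = "x' (Suc (Suc n))"
    have 1: "?a (Suc n) j \<le> R (Suc n) * ?b (Suc n) j" if j: "j \<in> ?S" for j
    proof -
      have "(\<Sum>i\<in>S. ?a n i * Q i j) = (\<Sum>i\<in>?S. ?a n i * Q i j) + ?a n x * Q x j" by (rule sumS)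
      also have "\<dots> \<le> (\<Sum>i\<in>?S. (R n * ?b n i) * (\<alpha> * Q' i j)) + (R n * \<rho> (Suc n) * ?b n ?x1) * (\<beta> * Q' ?x1 j)"
        by (intro add_mono sum_mono mult_mono IH1 IH2 Q mult_nonneg_nonneg R0 b0 \<rho>0) (use S j in auto)
      also have "\<dots> = R n * \<alpha> * (\<Sum>i\<in>?S. ?b n i * Q' i j) + R n * \<rho> (Suc n) * \<beta> * (?b n ?x1 * Q' ?x1 j)"
        by (simp add: sum_distrib_left mult_ac)
      also have "\<dots> \<le> R n * \<alpha> * (\<Sum>i\<in>?S. ?b n i * Q' i j) + R n * \<rho> (Suc n) * \<beta> * (\<Sum>i\<in>?S. ?b n i * Q' i j)"
        by (intro add_left_mono mult_left_mono single mult_nonneg_nonneg R0 \<rho>0 j) (use c in auto)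
      also have "\<dots> = R (Suc n) * (\<Sum>i\<in>?S. ?b n i * Q' i j)" by (simp add: RS algebra_simps)
      finally have "(\<Sum>i\<in>S. ?a n i * Q i j) * e (Suc (Suc n)) j \<le> R (Suc n) * (\<Sum>i\<in>?S. ?b n i * Q' i j) * e (Suc (Suc n)) j"
        by (rule mult_right_mono) (use j e in auto)
      then show ?thesis by (simp add: mult_ac)
    qed
    let ?s = "\<Sum>i\<in>?S. ?b n i * Q' i ?x2"
    have s0: "0 \<le> ?s" using b0 Q(2) S by (intro sum_nonneg mult_nonneg_nonneg) auto
    have "(\<Sum>i\<in>S. ?a n i * Q i x) = (\<Sum>i\<in>?S. ?a n i * Q i x) + ?a n x * Q x x" by (rule sumS)
    also have "\<dots> \<le> (\<Sum>i\<in>?S. (R n * ?b n i) * (\<beta> * Q' i ?x2)) + (R n * \<rho> (Suc n) * ?b n ?x1) * (\<beta> * Q' ?x1 ?x2)"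
      by (intro add_mono sum_mono mult_mono IH1 IH2 Q mult_nonneg_nonneg R0 b0 \<rho>0) (use S in auto)
    also have "\<dots> = R n * \<beta> * ?s + R n * \<rho> (Suc n) * \<beta> * (?b n ?x1 * Q' ?x1 ?x2)"
      by (simp add: sum_distrib_left mult_ac)
    also have "\<dots> \<le> R n * \<beta> * ?s + R n * \<rho> (Suc n) * \<beta> * ?s"
      by (intro add_left_mono mult_left_mono single mult_nonneg_nonneg R0 \<rho>0) (use c S in auto)
    \<comment> \<open>Since \<open>\<alpha> \<le> 1 \<le> \<beta>\<close>, the factor
      \<open>1 + \<rho>\<close> is at most the growth factor
      \<open>\<alpha> + \<beta> * \<rho>\<close> of \<open>R\<close>, divided by
      \<open>\<alpha>\<close>.\<close>
    also have "\<dots> = (R n * \<beta> * ?s / \<alpha>) * (\<alpha> + \<alpha> * \<rho> (Suc n))" using c by (simp add: field_simps)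
    also have "\<dots> \<le> (R n * \<beta> * ?s / \<alpha>) * (\<alpha> + \<beta> * \<rho> (Suc n))"
      by (intro mult_left_mono add_left_mono mult_right_mono) (use c \<rho>0 R0 s0 in auto)
    also have "\<dots> = R (Suc n) * (\<beta> / \<alpha>) * ?s" by (simp add: RS field_simps)
    finally have "(\<Sum>i\<in>S. ?a n i * Q i x) * e (Suc (Suc n)) x
        \<le> (R (Suc n) * (\<beta> / \<alpha>) * ?s) * (r (Suc (Suc n)) * e (Suc (Suc n)) ?x2)"
      by (intro mult_mono e) (use S c R0 s0 e in auto)
    also have "\<dots> = R (Suc n) * \<rho> (Suc (Suc n)) * ?b (Suc n) ?x2"
      by (simp add: \<rho>_def mult_ac)
    finally have "?a (Suc n) x \<le> R (Suc n) * \<rho> (Suc (Suc n)) * ?b (Suc n) ?x2" by simp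
    with 1 show ?case by blast
  qed
  have "lik S p Q e (Suc n) = (\<Sum>j\<in>?S. ?a n j) + ?a n x" unfolding lik_fwd by (rule sumS)
  also have "\<dots> \<le> (\<Sum>j\<in>?S. R n * ?b n j) + R n * \<rho> (Suc n) * ?b n (x' (Suc n))"
    using main[of n] by (intro add_mono sum_mono) auto
  also have "\<dots> \<le> R n * (\<Sum>j\<in>?S. ?b n j) + R n * \<rho> (Suc n) * (\<Sum>j\<in>?S. ?b n j)"
    unfolding sum_distrib_left[symmetric]
    by (intro add_left_mono mult_left_mono member_le_sum mult_nonneg_nonneg R0 \<rho>0 b0) (use S in auto)
  also have "\<dots> = (R n * lik ?S p' Q' e (Suc n)) * (1 + \<rho> (Suc n))" by (simp add: lik_fwd algebra_simps)
  also have "\<dots> \<le> (R n * lik ?S p' Q' e (Suc n)) * (1 + (\<beta> / \<alpha>)\<^sup>2 * r (Suc n))"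
  proof (intro mult_left_mono add_left_mono)
    have "1 \<le> \<beta> / \<alpha>" using c by (simp add: field_simps)
    then have "\<beta> / \<alpha> \<le> (\<beta> / \<alpha>)\<^sup>2" by (rule self_le_power) simp
    then have "(\<beta> / \<alpha>) * r (Suc n) \<le> (\<beta> / \<alpha>)\<^sup>2 * r (Suc n)"
      using c by (intro mult_right_mono)
    then show "\<rho> (Suc n) \<le> (\<beta> / \<alpha>)\<^sup>2 * r (Suc n)" by (simp add: \<rho>_def)
    show "0 \<le> R n * lik ?S p' Q' e (Suc n)" unfolding lik_fwd
      by (intro mult_nonneg_nonneg R0 sum_nonneg b0)
  qed
  also have "\<dots> = C * \<alpha> ^ n * (\<Prod>t\<in>{1..Suc n}. 1 + (\<beta> / \<alpha>)\<^sup>2 * r t) * lik ?S p' Q' e (Suc n)"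
    by (simp add: R_def)
  finally show ?thesis .
qed

section \<open>A one-sided strong law\<close>

text \<open>Both halves are geometric: the terms with \<open>2 ^ k \<le> w\<close> equal
  \<open>2 ^ k\<close>, the later ones \<open>w\<^sup>2 / 2 ^ k\<close>, and each group adds up to
  at most \<open>2 * w\<close>.\<close>

lemma sum_truncated_squares_le:
  fixes w :: real
  assumes "0 \<le> w"
  shows "(\<Sum>k<N. (min w (2 ^ k))\<^sup>2 / 2 ^ k) \<le> 4 * w"
proof -
  \<comment> \<open>The induction needs the part still to come: \<open>2 * w\<^sup>2 / 2 ^ N\<close>
    is the sum of \<open>w\<^sup>2 / 2 ^ k\<close> over all \<open>k \<ge> N\<close>.\<close>
  have "(\<Sum>k<N. (min w (2 ^ k))\<^sup>2 / 2 ^ k) \<le> (if 2 ^ N \<le> w then 2 ^ N else 4 * w - 2 * w\<^sup>2 / 2 ^ N)"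
  proof (induction N)
    case 0
    have "w < 1 \<Longrightarrow> w * w \<le> 1 * w" using assms by (intro mult_right_mono) auto
    then show ?case using assms by (auto simp: power2_eq_square)
  next
    case (Suc N)
    consider "2 ^ Suc N \<le> w" | "2 ^ N \<le> w" "w < 2 ^ Suc N" | "w < 2 ^ N" by fastforce
    then show ?case
    proof cases
      case 1
      then have "2 ^ N \<le> w" using power_increasing[of N "Suc N" "2::real"] by linarith
      then show ?thesis using Suc 1 by (simp add: power2_eq_square)
    next
      case 2
      have "w\<^sup>2 / 2 ^ Suc N \<le> w" using 2 assms by (simp add: power2_eq_square divide_le_eq mult_left_mono)
      then show ?thesis using Suc 2 by (simp add: power2_eq_square)
    next
      case 3
      then have "w < 2 ^ Suc N" using power_increasing[of N "Suc N" "2::real"] by linarith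
      then show ?thesis using Suc 3 by (simp add: min_def)
    qed
  qed
  also have "\<dots> \<le> 4 * w" using assms by auto
  finally show ?thesis .
qed

text \<open>Etemadi's argument along powers of 2: truncation at \<open>2 ^ k\<close>, Chebyshev and Borel--Cantelli
  control the sums up to \<open>2 ^ k\<close>, and nonnegativity fills the gaps at the price of a factor 2.\<close>

lemma (in prob_space) eventually_sum_le_if_expectation_less:
  fixes W :: "nat \<Rightarrow> 'a \<Rightarrow> real"
  assumes rv[measurable]: "\<And>t. random_variable borel (W t)"
    and nonneg: "\<And>t \<omega>. 0 \<le> W t \<omega>"
    and indep: "\<And>s t. 1 \<le> s \<Longrightarrow> 1 \<le> t \<Longrightarrow> s \<noteq> t \<Longrightarrow> indep_var borel (W s) borel (W t)"
    and ident: "\<And>t. 1 \<le> t \<Longrightarrow> distr M borel (W t) = distr M borel (W 1)"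
    and int: "integrable M (W 1)"
    and C: "2 * expectation (W 1) < C"
  shows "AE \<omega> in M. eventually (\<lambda>n. (\<Sum>t\<in>{1..n}. W t \<omega>) \<le> C * real n) sequentially"
proof -
  define \<mu> where "\<mu> = expectation (W 1)"
  \<comment> \<open>So \<open>\<mu> + \<epsilon> = C / 2\<close>; the other factor 2 pays for
    passing from \<open>n\<close> to the next power of 2.\<close>
  define \<epsilon> where "\<epsilon> = C / 2 - \<mu>"
  have \<epsilon>: "0 < \<epsilon>" using C by (simp add: \<epsilon>_def \<mu>_def)
  define V where "V k t \<omega> = min (W t \<omega>) (2 ^ k)" for k t \<omega>
  define v where "v k = expectation (V k 1)" for k
  define q where "q k = expectation (\<lambda>\<omega>. (V k 1 \<omega>)\<^sup>2)" for k
  have V_bound: "0 \<le> V k t \<omega>" "V k t \<omega> \<le> 2 ^ k" for k t \<omega> using nonneg by (auto simp: V_def)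
  have [measurable]: "random_variable borel (V k t)" for k t unfolding V_def by measurable
  have E_eq: "expectation (\<lambda>\<omega>. h (W t \<omega>)) = expectation (\<lambda>\<omega>. h (W 1 \<omega>))"
    if "h \<in> borel_measurable borel" "1 \<le> t" for h :: "real \<Rightarrow> real" and t
    using that ident[OF that(2)] integral_distr[OF rv that(1), of t] integral_distr[OF rv that(1), of 1] by simp
  have V_int: "integrable M (V k t)" for k t
    by (rule integrable_const_bound[of _ "2 ^ k"]) (use V_bound in auto)
  have V2_int: "integrable M (\<lambda>\<omega>. (V k t \<omega>)\<^sup>2)" for k t
    by (rule integrable_const_bound[of _ "(2 ^ k)\<^sup>2"]) (use V_bound in \<open>auto intro!: power_mono\<close>)
  have EV: "expectation (V k t) = v k" if "1 \<le> t" for k t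
    using E_eq[of "\<lambda>x. min x (2 ^ k)" t] that by (simp add: V_def[abs_def] v_def)
  have EV2: "expectation (\<lambda>\<omega>. (V k t \<omega>)\<^sup>2) = q k" if "1 \<le> t" for k t
    using E_eq[of "\<lambda>x. (min x (2 ^ k))\<^sup>2" t] that by (simp add: V_def[abs_def] q_def)
  have v_le: "v k \<le> \<mu>" for k
    unfolding v_def \<mu>_def by (intro integral_mono V_int int) (simp add: V_def)
  define S where "S k \<omega> = (\<Sum>t\<in>{1..2 ^ k}. V k t \<omega>)" for k \<omega>
  have [measurable]: "random_variable borel (S k)" for k unfolding S_def by measurable
  have ES: "expectation (S k) = 2 ^ k * v k" for k
    unfolding S_def using EV by (simp add: V_int)
  have S_bound: "0 \<le> S k \<omega>" "S k \<omega> \<le> 2 ^ k * 2 ^ k" for k \<omega>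
    using sum_bounded_above[of "{1..2 ^ k}" "\<lambda>t. V k t \<omega>" "2 ^ k"] V_bound
    by (auto simp: S_def intro: sum_nonneg)
  have varS: "variance (S k) \<le> 2 ^ k * q k" for k
  proof -
    let ?U = "\<lambda>t \<omega>. V k t \<omega> - v k"
    have U_int: "integrable M (?U t)" for t by (simp add: V_int)
    have v0: "0 \<le> v k" "v k \<le> 2 ^ k" 
      using integral_mono[OF V_int integrable_const, of k 1 "2 ^ k"] V_bound
      by (auto simp: v_def prob_space intro!: integral_nonneg_AE)
    have UU_int: "integrable M (\<lambda>\<omega>. ?U s \<omega> * ?U t \<omega>)" for s t
    proof (rule integrable_const_bound[of _ "2 ^ k * 2 ^ k"])
      show "AE \<omega> in M. norm (?U s \<omega> * ?U t \<omega>) \<le> 2 ^ k * 2 ^ k"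
        unfolding real_norm_def abs_mult using V_bound v0
        by (intro AE_I2 mult_mono) (smt (verit))+
    qed measurable
    \<comment> \<open>Off the diagonal independence of the pair makes the covariance vanish, so the
      variance grows only like the number of summands.\<close>
    have cov: "expectation (\<lambda>\<omega>. ?U s \<omega> * ?U t \<omega>) \<le> (if s = t then q k else 0)"
      if st: "s \<in> {1..2 ^ k}" "t \<in> {1..2 ^ k}" for s t
    proof (cases "s = t")
      case True
      have "expectation (\<lambda>\<omega>. ?U t \<omega> * ?U t \<omega>)
          = expectation (\<lambda>\<omega>. (V k t \<omega>)\<^sup>2 - 2 * v k * V k t \<omega> + (v k)\<^sup>2)"
        by (intro Bochner_Integration.integral_cong) (auto simp: power2_eq_square algebra_simps)
      also have "\<dots> = q k - 2 * v k * v k + (v k)\<^sup>2"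
        using st by (simp add: V_int V2_int EV EV2 prob_space)
      also have "\<dots> \<le> q k" by (simp add: power2_eq_square)
      finally show ?thesis using True by simp
    next
      case False
      have "indep_var borel ((\<lambda>x. min x (2 ^ k) - v k) \<circ> W s) borel ((\<lambda>x. min x (2 ^ k) - v k) \<circ> W t)"
        by (intro indep_var_compose[OF indep]) (use st False in auto)
      then have "expectation (\<lambda>\<omega>. ?U s \<omega> * ?U t \<omega>) = expectation (?U s) * expectation (?U t)"
        by (intro indep_var_lebesgue_integral U_int) (simp add: V_def comp_def)
      also have "expectation (?U s) = 0" using st by (simp add: V_int EV prob_space)
      finally show ?thesis using False by simp
    qed
    have "variance (S k) = expectation (\<lambda>\<omega>. \<Sum>s\<in>{1..2 ^ k}. \<Sum>t\<in>{1..2 ^ k}. ?U s \<omega> * ?U t \<omega>)"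
      unfolding ES by (simp add: S_def sum_subtractf sum_product[symmetric] power2_eq_square)
    also have "\<dots> = (\<Sum>s\<in>{1..2 ^ k}. \<Sum>t\<in>{1..2 ^ k}. expectation (\<lambda>\<omega>. ?U s \<omega> * ?U t \<omega>))"
      by (simp add: UU_int)
    also have "\<dots> \<le> (\<Sum>s\<in>{1..2 ^ k :: nat}. \<Sum>t\<in>{1..2 ^ k}. if s = t then q k else 0)"
      by (intro sum_mono cov)
    also have "\<dots> = 2 ^ k * q k" by simp
    finally show ?thesis .
  qed
  define A where "A k = {\<omega> \<in> space M. 2 ^ k * (\<mu> + \<epsilon>) \<le> (\<Sum>t\<in>{1..2 ^ k}. W t \<omega>)}" for k
  have [measurable]: "A k \<in> sets M" for k unfolding A_def by measurable
  have probA: "prob (A k) \<le> (1 / \<epsilon>\<^sup>2 + 1) * (q k / 2 ^ k)" for k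
  proof -
    let ?B = "{\<omega> \<in> space M. 2 ^ k * \<epsilon> \<le> \<bar>S k \<omega> - expectation (S k)\<bar>}"
    \<comment> \<open>Reaching the truncation level is written with squares so that Markov's
      inequality yields \<open>q k / (2 ^ k)\<^sup>2\<close>. Over \<open>2 ^ k\<close> times this
      adds up to \<open>q k / 2 ^ k\<close>, the same order as the Chebyshev term.\<close>
    let ?D = "\<lambda>t. {\<omega> \<in> space M. (2 ^ k)\<^sup>2 \<le> (V k t \<omega>)\<^sup>2}"
    have "A k \<subseteq> ?B \<union> (\<Union>t\<in>{1..2 ^ k}. ?D t)"
    proof
      fix \<omega> assume \<omega>: "\<omega> \<in> A k"
      show "\<omega> \<in> ?B \<union> (\<Union>t\<in>{1..2 ^ k}. ?D t)"
      proof (cases "\<exists>t\<in>{1..2 ^ k}. 2 ^ k \<le> W t \<omega>")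
        case True
        then obtain t where "t \<in> {1..2 ^ k}" "V k t \<omega> = 2 ^ k" by (auto simp: V_def min_absorb2)
        then show ?thesis using \<omega> by (auto simp: A_def intro!: bexI[of _ t])
      next
        case False
        then have "(\<Sum>t\<in>{1..2 ^ k}. W t \<omega>) = S k \<omega>" by (auto simp: S_def V_def intro!: sum.cong)
        then have "2 ^ k * (\<mu> + \<epsilon>) \<le> S k \<omega>" using \<omega> by (simp add: A_def)
        moreover have "expectation (S k) \<le> 2 ^ k * \<mu>" using v_le by (simp add: ES)
        ultimately have "2 ^ k * \<epsilon> \<le> S k \<omega> - expectation (S k)" by (simp add: distrib_left)
        then show ?thesis using \<omega> by (auto simp: A_def)
      qed
    qed
    then have "prob (A k) \<le> prob (?B \<union> (\<Union>t\<in>{1..2 ^ k}. ?D t))" by (intro finite_measure_mono) auto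
    also have "\<dots> \<le> prob ?B + prob (\<Union>t\<in>{1..2 ^ k}. ?D t)" by (intro measure_Un_le) auto
    also have "\<dots> \<le> prob ?B + (\<Sum>t\<in>{1..2 ^ k}. prob (?D t))"
      by (intro add_left_mono measure_UNION_le) auto
    also have "\<dots> \<le> 2 ^ k * q k / (2 ^ k * \<epsilon>)\<^sup>2 + (\<Sum>t\<in>{1..2 ^ k :: nat}. q k / (2 ^ k)\<^sup>2)"
    proof (intro add_mono sum_mono)
      have "prob ?B \<le> variance (S k) / (2 ^ k * \<epsilon>)\<^sup>2"
        by (rule Chebyshev_inequality)
          (use \<epsilon> S_bound in \<open>auto intro!: integrable_const_bound[of _ "(2 ^ k * 2 ^ k)\<^sup>2"] power_mono\<close>)
      also have "\<dots> \<le> 2 ^ k * q k / (2 ^ k * \<epsilon>)\<^sup>2" by (intro divide_right_mono varS) auto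
      finally show "prob ?B \<le> 2 ^ k * q k / (2 ^ k * \<epsilon>)\<^sup>2" .
    next
      fix t :: nat assume "t \<in> {1..2 ^ k}"
      then show "prob (?D t) \<le> q k / (2 ^ k)\<^sup>2"
        using integral_Markov_inequality_measure[OF V2_int sets.empty_sets, of k t "(2 ^ k)\<^sup>2"] EV2 by auto
    qed
    also have "\<dots> = (1 / \<epsilon>\<^sup>2 + 1) * (q k / 2 ^ k)"
      using \<epsilon> by (simp add: field_simps power2_eq_square)
    finally show ?thesis .
  qed
  have q0: "0 \<le> q k" for k unfolding q_def by simp
  \<comment> \<open>The partial sums are expectations of the truncated squares of
    \<open>W 1\<close>, which are bounded pointwise by \<open>4 * W 1\<close>.\<close>
  have "summable (\<lambda>k. q k / 2 ^ k)"
  proof (rule summableI_nonneg_bounded)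
    fix N
    have "(\<Sum>k<N. q k / 2 ^ k) = expectation (\<lambda>\<omega>. \<Sum>k<N. (V k 1 \<omega>)\<^sup>2 / 2 ^ k)"
      by (simp add: q_def V2_int)
    also have "\<dots> \<le> expectation (\<lambda>\<omega>. 4 * W 1 \<omega>)"
      by (intro integral_mono) (use V2_int int nonneg sum_truncated_squares_le in \<open>auto simp: V_def\<close>)
    finally show "(\<Sum>k<N. q k / 2 ^ k) \<le> 4 * \<mu>" using int by (simp add: \<mu>_def)
  qed (use q0 in auto)
  then have "summable (\<lambda>k. (1 / \<epsilon>\<^sup>2 + 1) * (q k / 2 ^ k))" by (rule summable_mult)
  then have "summable (\<lambda>k. prob (A k))"
    by (rule summable_comparison_test') (use probA in auto)
  then have "AE \<omega> in M. eventually (\<lambda>k. \<omega> \<in> space M - A k) sequentially"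
    by (intro borel_cantelli_AE1) (auto simp: emeasure_eq_measure)
  then show ?thesis
  proof eventually_elim
    case (elim \<omega>)
    then obtain k0 where k0: "\<And>k. k \<ge> k0 \<Longrightarrow> \<omega> \<in> space M - A k" by (auto simp: eventually_sequentially)
    show ?case unfolding eventually_sequentially
    proof (intro exI allI impI)
      fix n :: nat assume n: "2 ^ k0 \<le> n"
      then have "n \<ge> 1" by (meson one_le_power one_le_numeral order_trans)
      then obtain k where k: "2 ^ k \<le> n" "n < 2 ^ Suc k" using ex_power_ivl1[of 2 n] by auto
      have "k0 \<le> Suc k" using n k(2) by (metis le_less_trans less_imp_le_nat power_less_imp_less_exp one_less_numeral_iff semiring_norm(76))
      then have "\<omega> \<in> space M - A (Suc k)" by (rule k0)
      then have *: "(\<Sum>t\<in>{1..2 ^ Suc k}. W t \<omega>) < 2 ^ Suc k * (\<mu> + \<epsilon>)" by (auto simp: A_def)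
      have \<mu>0: "0 \<le> \<mu>" unfolding \<mu>_def using nonneg by (intro integral_nonneg_AE) auto
      have "(\<Sum>t\<in>{1..n}. W t \<omega>) \<le> (\<Sum>t\<in>{1..2 ^ Suc k}. W t \<omega>)"
        using k nonneg by (intro sum_mono2) auto
      also have "\<dots> \<le> 2 ^ k * C" using * by (simp add: \<epsilon>_def)
      also have "\<dots> \<le> real n * C"
      proof (intro mult_right_mono)
        show "(2::real) ^ k \<le> real n" using k(1) by (metis of_nat_le_iff of_nat_numeral of_nat_power)
        show "0 \<le> C" using C \<mu>0 by (simp add: \<mu>_def)
      qed
      finally show "(\<Sum>t\<in>{1..n}. W t \<omega>) \<le> C * real n" by (simp add: mult.commute)
    qed
  qed
qed

section \<open>The hidden Markov chain and its noise\<close>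

lemma lik_one:
  assumes "(\<Sum>i\<in>S. p i) = 1" "\<And>i. i \<in> S \<Longrightarrow> (\<Sum>j\<in>S. Q i j) = 1"
  shows "lik S p Q (\<lambda>_ _. 1) (Suc n) = 1"
proof (induction n)
  case 0
  then show ?case using assms by (simp add: lik_fwd)
next
  case (Suc n)
  have "lik S p Q (\<lambda>_ _. 1) (Suc (Suc n)) = (\<Sum>i\<in>S. fwd S p Q (\<lambda>_ _. 1) n i * (\<Sum>j\<in>S. Q i j))"
    unfolding lik_fwd by (simp add: sum_distrib_left, subst sum.swap) simp
  also have "\<dots> = lik S p Q (\<lambda>_ _. 1) (Suc n)" using assms by (simp add: lik_fwd)
  finally show ?case using Suc by simp
qed

text \<open>The product form of \<open>joint_law\<close> on path-and-box events carries the Markov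
  property and all independence of chain and noise; every probabilistic fact about the data is
  derived from it.\<close>

locale hmm_data = prob_space P
  for P :: "'w measure" +
  fixes X :: "nat \<Rightarrow> 'w \<Rightarrow> nat" and Z :: "nat \<Rightarrow> nat \<Rightarrow> 'w \<Rightarrow> real"
    and k :: nat and p :: "nat \<Rightarrow> real" and Q :: "nat \<Rightarrow> nat \<Rightarrow> real" and \<sigma> :: real
    and f :: "nat \<Rightarrow> real \<Rightarrow> real"
  assumes p: "prob_vec k p" and Q: "stoch_mat_lb \<sigma> k Q" and \<sigma>: "0 < \<sigma>" "\<sigma> < 1"
    and dens: "\<And>x. x \<in> {1..k} \<Longrightarrow> is_density (f x)"
    and X_meas[measurable]: "\<And>t. X t \<in> measurable P (count_space UNIV)"
    and Z_meas[measurable]: "\<And>x t. Z x t \<in> borel_measurable P"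
    and joint_law: "\<And>n xs B. n \<ge> 1 \<Longrightarrow> xs \<in> PiE {1..n} (\<lambda>_. {1..k}) \<Longrightarrow> (\<And>x t. B x t \<in> sets borel) \<Longrightarrow>
         emeasure P {\<omega> \<in> space P. (\<forall>t\<in>{1..n}. X t \<omega> = xs t)
                                 \<and> (\<forall>x\<in>{1..k}. \<forall>t\<in>{1..n}. Z x t \<omega> \<in> B x t)}
         = ennreal (p (xs 1) * (\<Prod>t\<in>{2..n}. Q (xs (t - 1)) (xs t)))
           * (\<Prod>x\<in>{1..k}. \<Prod>t\<in>{1..n}. emeasure (density lborel (\<lambda>z. ennreal (f x z))) (B x t))"
begin

abbreviation "noise x \<equiv> density lborel (\<lambda>z. ennreal (f x z))"
abbreviation "paths (n::nat) \<equiv> PiE {1..n} (\<lambda>_. {1..k})"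
abbreviation "path_weight (n::nat) (xs :: nat \<Rightarrow> nat) \<equiv> p (xs 1) * (\<Prod>t\<in>{2..n}. Q (xs (t - 1)) (xs t))"

lemma p_nonneg: "i \<in> {1..k} \<Longrightarrow> 0 \<le> p i" and p_sum: "(\<Sum>i\<in>{1..k}. p i) = 1"
  using p by (auto simp: prob_vec_def)

lemma Q_ge: "i \<in> {1..k} \<Longrightarrow> j \<in> {1..k} \<Longrightarrow> \<sigma> \<le> Q i j"
  and Q_sum: "i \<in> {1..k} \<Longrightarrow> (\<Sum>j\<in>{1..k}. Q i j) = 1"
  using Q by (auto simp: stoch_mat_lb_def)

lemma Q_nonneg: "i \<in> {1..k} \<Longrightarrow> j \<in> {1..k} \<Longrightarrow> 0 \<le> Q i j"
  using Q_ge[of i j] \<sigma> by linarith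

lemma path_weight_nonneg: "n \<ge> 1 \<Longrightarrow> xs \<in> paths n \<Longrightarrow> 0 \<le> path_weight n xs"
proof (intro mult_nonneg_nonneg prod_nonneg p_nonneg Q_nonneg)
  fix t assume "xs \<in> paths n" "t \<in> {2..n}"
  moreover from this have "t - 1 \<in> {1..n}" "t \<in> {1..n}" by auto
  ultimately show "xs (t - 1) \<in> {1..k}" "xs t \<in> {1..k}" by blast+
qed auto

lemma sum_path_weight: "n \<ge> 1 \<Longrightarrow> (\<Sum>xs\<in>paths n. path_weight n xs) = 1"
  using lik_one[where S = "{1..k}" and p = p and Q = Q and n = "n - 1"] p_sum Q_sum by (simp add: lik_def)

lemma emeasure_noise_UNIV: "x \<in> {1..k} \<Longrightarrow> emeasure (noise x) UNIV = 1"
  using dens[of x] by (simp add: is_density_def emeasure_density)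

lemma prob_path:
  assumes "n \<ge> 1" "xs \<in> paths n"
  shows "prob {\<omega> \<in> space P. \<forall>t\<in>{1..n}. X t \<omega> = xs t} = path_weight n xs"
proof -
  have "emeasure P {\<omega> \<in> space P. \<forall>t\<in>{1..n}. X t \<omega> = xs t} = ennreal (path_weight n xs)"
    using joint_law[OF assms, of "\<lambda>_ _. UNIV"] by (simp add: emeasure_noise_UNIV)
  then show ?thesis using path_weight_nonneg[OF assms] by (simp add: measure_def)
qed

text \<open>The law is prescribed on paths inside the state space only. These are disjoint events
  whose probabilities add up to 1, so nothing is left for other paths.\<close>

lemma AE_X_in: "AE \<omega> in P. \<forall>t\<ge>1. X t \<omega> \<in> {1..k}"
proof -
  have "AE \<omega> in P. n \<ge> 1 \<longrightarrow> X n \<omega> \<in> {1..k}" for n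
  proof (cases "n \<ge> 1")
    case True
    let ?A = "\<lambda>xs. {\<omega> \<in> space P. \<forall>t\<in>{1..n}. X t \<omega> = xs t}"
    have "prob (\<Union>xs\<in>paths n. ?A xs) = (\<Sum>xs\<in>paths n. prob (?A xs))"
    proof (rule finite_measure_finite_Union)
      show "finite (paths n)" by (intro finite_PiE) auto
      show "disjoint_family_on ?A (paths n)"
        unfolding disjoint_family_on_def
      proof (intro ballI impI)
        fix xs ys assume "xs \<in> paths n" "ys \<in> paths n" "xs \<noteq> ys"
        then obtain t where "t \<in> {1..n}" "xs t \<noteq> ys t" by (meson PiE_ext)
        then show "?A xs \<inter> ?A ys = {}" by auto
      qed
    qed auto
    also have "\<dots> = 1" using prob_path[OF True] sum_path_weight[OF True] by simp
    finally have *: "prob (\<Union>xs\<in>paths n. ?A xs) = 1" .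
    have "AE \<omega> in P. \<omega> \<in> (\<Union>xs\<in>paths n. ?A xs)"
      by (subst prob_eq_1[symmetric]) (use * in \<open>auto intro!: sets.finite_UN finite_PiE\<close>)
    then show ?thesis by eventually_elim (auto simp: PiE_iff)
  qed auto
  then show ?thesis by (subst AE_all_countable) auto
qed

lemma AE_X_path: "AE \<omega> in P. \<forall>n. restrict (\<lambda>t. X t \<omega>) {1..n} \<in> paths n"
  using AE_X_in by eventually_elim auto

text \<open>The lower bound on the true likelihood contains the logarithm of the initial weight of
  the realised path, which therefore must not vanish.\<close>

lemma AE_p_X1_pos: "AE \<omega> in P. 0 < p (X 1 \<omega>)"
proof -
  have "AE \<omega> in P. X 1 \<omega> = i \<longrightarrow> 0 < p i" if i: "i \<in> {1..k}" for i
  proof (cases "p i = 0")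
    case True
    have "prob {\<omega> \<in> space P. \<forall>t\<in>{1..1}. X t \<omega> = restrict (\<lambda>_. i) {1..1} t} = 0"
      by (subst prob_path) (use i True in auto)
    then have "AE \<omega> in P. \<not> (\<forall>t\<in>{1..1}. X t \<omega> = restrict (\<lambda>_. i) {1..1} t)"
      by (subst (asm) prob_Collect_eq_0) auto
    then show ?thesis by eventually_elim auto
  next
    case False
    then show ?thesis using p_nonneg[OF i] by auto
  qed
  then have "AE \<omega> in P. \<forall>i\<in>{1..k}. X 1 \<omega> = i \<longrightarrow> 0 < p i" by (subst AE_ball_countable) auto
  with AE_X_in show ?thesis by eventually_elim auto
qed

text \<open>Summing the joint law over all hidden paths removes the chain, since the path weights
  add up to 1.\<close>

lemma emeasure_Z:
  assumes n: "n \<ge> 1" and B: "\<And>x t. B x t \<in> sets borel"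
  shows "emeasure P {\<omega> \<in> space P. \<forall>x\<in>{1..k}. \<forall>t\<in>{1..n}. Z x t \<omega> \<in> B x t}
    = (\<Prod>x\<in>{1..k}. \<Prod>t\<in>{1..n}. emeasure (noise x) (B x t))" (is "_ = ?c")
proof -
  let ?A = "\<lambda>xs. {\<omega> \<in> space P. (\<forall>t\<in>{1..n}. X t \<omega> = xs t) \<and> (\<forall>x\<in>{1..k}. \<forall>t\<in>{1..n}. Z x t \<omega> \<in> B x t)}"
  have A_sets: "?A xs \<in> sets P" for xs using B by measurable
  have fin: "finite (paths n)" by (intro finite_PiE) auto
  have "emeasure P {\<omega> \<in> space P. \<forall>x\<in>{1..k}. \<forall>t\<in>{1..n}. Z x t \<omega> \<in> B x t} = emeasure P (\<Union>xs\<in>paths n. ?A xs)"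
  proof (rule emeasure_eq_AE)
    show "AE \<omega> in P. (\<omega> \<in> {\<omega> \<in> space P. \<forall>x\<in>{1..k}. \<forall>t\<in>{1..n}. Z x t \<omega> \<in> B x t}) = (\<omega> \<in> (\<Union>xs\<in>paths n. ?A xs))"
      using AE_X_path
    proof eventually_elim
      case (elim \<omega>)
      then have "restrict (\<lambda>t. X t \<omega>) {1..n} \<in> paths n" by blast
      then show ?case by (fastforce intro: bexI[of _ "restrict (\<lambda>t. X t \<omega>) {1..n}"])
    qed
    show "{\<omega> \<in> space P. \<forall>x\<in>{1..k}. \<forall>t\<in>{1..n}. Z x t \<omega> \<in> B x t} \<in> sets P" using B by measurable
    show "(\<Union>xs\<in>paths n. ?A xs) \<in> sets P" using fin A_sets by (intro sets.finite_UN) blast+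
  qed
  also have "\<dots> = (\<Sum>xs\<in>paths n. emeasure P (?A xs))"
  proof (rule sum_emeasure[symmetric])
    show "disjoint_family_on ?A (paths n)"
      unfolding disjoint_family_on_def
    proof (intro ballI impI)
      fix xs ys assume "xs \<in> paths n" "ys \<in> paths n" "xs \<noteq> ys"
      then obtain t where "t \<in> {1..n}" "xs t \<noteq> ys t" by (meson PiE_ext)
      then show "?A xs \<inter> ?A ys = {}" by auto
    qed
    show "?A ` paths n \<subseteq> events" using A_sets by blast
  qed (fact fin)
  also have "\<dots> = (\<Sum>xs\<in>paths n. ennreal (path_weight n xs) * ?c)"
    by (intro sum.cong refl joint_law n B)
  also have "\<dots> = ennreal (\<Sum>xs\<in>paths n. path_weight n xs) * ?c"
    by (simp add: sum_distrib_right[symmetric] sum_ennreal path_weight_nonneg n del: One_nat_def)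
  also have "\<dots> = ?c" using sum_path_weight[OF n] by simp
  finally show ?thesis .
qed

lemma emeasure_Z_pair:
  assumes x: "x \<in> {1..k}" and st: "1 \<le> s" "1 \<le> t" "s \<noteq> t" and A: "A \<in> sets borel" "B \<in> sets borel"
  shows "emeasure P {\<omega> \<in> space P. Z x s \<omega> \<in> A \<and> Z x t \<omega> \<in> B} = emeasure (noise x) A * emeasure (noise x) B"
proof -
  define C where "C x' t' = (if x' = x then if t' = s then A else if t' = t then B else UNIV else UNIV)" for x' t' :: nat
  let ?n = "max s t"
  have "{\<omega> \<in> space P. Z x s \<omega> \<in> A \<and> Z x t \<omega> \<in> B}
      = {\<omega> \<in> space P. \<forall>x'\<in>{1..k}. \<forall>t'\<in>{1..?n}. Z x' t' \<omega> \<in> C x' t'}"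
  proof (intro Collect_cong conj_cong refl iffI ballI)
    fix \<omega> x' t' assume "Z x s \<omega> \<in> A \<and> Z x t \<omega> \<in> B"
    then show "Z x' t' \<omega> \<in> C x' t'" by (auto simp: C_def)
  next
    fix \<omega> assume H: "\<forall>x'\<in>{1..k}. \<forall>t'\<in>{1..?n}. Z x' t' \<omega> \<in> C x' t'"
    have "Z x s \<omega> \<in> C x s" "Z x t \<omega> \<in> C x t" using H x st by auto
    then show "Z x s \<omega> \<in> A \<and> Z x t \<omega> \<in> B" using st by (simp add: C_def)
  qed
  also have "emeasure P \<dots> = (\<Prod>x'\<in>{1..k}. \<Prod>t'\<in>{1..?n}. emeasure (noise x') (C x' t'))"
    by (rule emeasure_Z) (use st A in \<open>auto simp: C_def\<close>)
  also have "\<dots> = (\<Prod>x'\<in>{1..k}. if x' = x then \<Prod>t'\<in>{1..?n}. emeasure (noise x) (C x t') else 1)"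
    by (intro prod.cong refl) (auto simp: C_def emeasure_noise_UNIV intro!: prod.neutral)
  also have "\<dots> = (\<Prod>t'\<in>{1..?n}. emeasure (noise x) (C x t'))" using x by (simp add: prod.delta)
  also have "\<dots> = (\<Prod>t'\<in>{s, t}. emeasure (noise x) (C x t'))"
    by (rule prod.mono_neutral_right) (use st x in \<open>auto simp: C_def emeasure_noise_UNIV\<close>)
  also have "\<dots> = emeasure (noise x) A * emeasure (noise x) B" using st by (simp add: C_def)
  finally show ?thesis .
qed

lemma distr_Z:
  assumes x: "x \<in> {1..k}" and t: "1 \<le> t"
  shows "distr P borel (Z x t) = noise x"
proof (rule measure_eqI)
  fix A assume "A \<in> sets (distr P borel (Z x t))"
  then have A[measurable]: "A \<in> sets borel" by simp
  have "emeasure P {\<omega> \<in> space P. Z x t \<omega> \<in> A \<and> Z x (Suc t) \<omega> \<in> UNIV} = emeasure (noise x) A * emeasure (noise x) UNIV"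
    by (rule emeasure_Z_pair) (use x t in auto)
  then show "emeasure (distr P borel (Z x t)) A = emeasure (noise x) A"
    using x by (simp add: emeasure_distr emeasure_noise_UNIV vimage_def Int_def conj_commute)
qed simp

lemma indep_Z:
  assumes x: "x \<in> {1..k}" and st: "1 \<le> s" "1 \<le> t" "s \<noteq> t"
  shows "indep_var borel (Z x s) borel (Z x t)"
  unfolding indep_var_eq
proof (intro conjI indep_setI)
  have sig: "sigma_sets (space P) {Z x t -` A \<inter> space P |A. A \<in> sets borel} = {Z x t -` A \<inter> space P |A. A \<in> sets borel}" for t
    unfolding sets_vimage_algebra[symmetric] by (rule sets_vimage_algebra2) simp
  have em: "prob (Z x t -` A \<inter> space P) = measure (noise x) A" if "1 \<le> t" "A \<in> sets borel" for t A
    using distr_Z[OF x that(1)] measure_distr[of "Z x t" P borel A] that by simp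
  show "sigma_sets (space P) {Z x s -` A \<inter> space P |A. A \<in> sets borel} \<subseteq> events"
    "sigma_sets (space P) {Z x t -` A \<inter> space P |A. A \<in> sets borel} \<subseteq> events"
    unfolding sig by auto
  fix a b assume "a \<in> sigma_sets (space P) {Z x s -` A \<inter> space P |A. A \<in> sets borel}"
    "b \<in> sigma_sets (space P) {Z x t -` A \<inter> space P |A. A \<in> sets borel}"
  then obtain A B where A: "A \<in> sets borel" "a = Z x s -` A \<inter> space P" and B: "B \<in> sets borel" "b = Z x t -` B \<inter> space P"
    unfolding sig by blast
  have "a \<inter> b = {\<omega> \<in> space P. Z x s \<omega> \<in> A \<and> Z x t \<omega> \<in> B}" using A B by auto
  then have "prob (a \<inter> b) = measure (noise x) A * measure (noise x) B"
    using emeasure_Z_pair[OF x st A(1) B(1)] by (simp add: measure_def enn2real_mult)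
  then show "prob (a \<inter> b) = prob a * prob b" using em A B st by simp
qed simp_all

lemma eventually_sum_Z_le:
  fixes F :: "real \<Rightarrow> real"
  assumes x: "x \<in> {1..k}" and F[measurable]: "F \<in> borel_measurable borel" and nonneg: "\<And>z. 0 \<le> F z"
    and int: "integrable P (\<lambda>\<omega>. F (Z x 1 \<omega>))" and C: "2 * expectation (\<lambda>\<omega>. F (Z x 1 \<omega>)) < C"
  shows "AE \<omega> in P. eventually (\<lambda>n. (\<Sum>t\<in>{1..n}. F (Z x t \<omega>)) \<le> C * real n) sequentially"
proof (rule eventually_sum_le_if_expectation_less)
  fix s t :: nat assume st: "1 \<le> s" "1 \<le> t" "s \<noteq> t"
  show "indep_var borel (\<lambda>\<omega>. F (Z x s \<omega>)) borel (\<lambda>\<omega>. F (Z x t \<omega>))"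
    using indep_var_compose[OF indep_Z[OF x st] F F] by (simp add: comp_def)
next
  fix t :: nat assume t: "1 \<le> t"
  have "distr P borel (\<lambda>\<omega>. F (Z x s \<omega>)) = distr (noise x) borel F" if "1 \<le> s" for s
    using distr_distr[OF F Z_meas, of x s] distr_Z[OF x that] by (simp add: comp_def)
  then show "distr P borel (\<lambda>\<omega>. F (Z x t \<omega>)) = distr P borel (\<lambda>\<omega>. F (Z x 1 \<omega>))" using t by simp
qed (use assms in auto)

text \<open>Chernoff bound: each transition lands in \<open>x\<close> with probability at least \<open>\<sigma>\<close>.\<close>

lemma ex_visit_frequency:
  obtains c where "0 < c"
    "\<And>x. x \<in> {1..k} \<Longrightarrow> AE \<omega> in P. eventually (\<lambda>n. c * real n \<le> real (card {t\<in>{1..n}. X t \<omega> = x})) sequentially"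
proof -
  \<comment> \<open>From state \<open>i\<close> the conditional mean of \<open>exp (- 1)\<close>
    raised to the indicator of a visit is \<open>1 - Q i x * (1 - exp (- 1))\<close>, and
    \<open>Q i x \<ge> \<sigma>\<close>.\<close>
  define \<rho> where "\<rho> = 1 - \<sigma> * (1 - exp (- 1))"
  have e1: "exp (- 1 :: real) < 1" "0 < exp (- 1 :: real)" by auto
  have "\<sigma> * (1 - exp (- 1)) < 1 * 1" using \<sigma> e1 by (intro mult_strict_mono) auto
  moreover have "0 < \<sigma> * (1 - exp (- 1))" using \<sigma> e1 by (intro mult_pos_pos) auto
  ultimately have \<rho>: "0 < \<rho>" "\<rho> < 1" by (auto simp: \<rho>_def)
  \<comment> \<open>As \<open>\<rho> = exp (- 2 * c)\<close>, the threshold \<open>c * n\<close>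
    uses half of the decay rate and the other half keeps the probabilities summable.\<close>
  define c where "c = - ln \<rho> / 2"
  have c: "0 < c" using \<rho> by (simp add: c_def)
  have \<rho>_eq: "\<rho> = exp (- 2 * c)" using \<rho> by (simp add: c_def)
  have "AE \<omega> in P. eventually (\<lambda>n. c * real n \<le> real (card {t\<in>{1..n}. X t \<omega> = x})) sequentially"
    if x: "x \<in> {1..k}" for x
  proof -
    define cnt where "cnt n xs = (\<Sum>t\<in>{1..n}. if xs t = x then 1 else 0 :: real)" for n and xs :: "nat \<Rightarrow> nat"
    have cnt_card: "cnt n xs = real (card {t\<in>{1..n}. xs t = x})" for n xs
      by (simp add: cnt_def sum.If_cases Int_def)
    define bad where "bad n = {\<omega> \<in> space P. cnt n (\<lambda>t. X t \<omega>) < c * real n}" for n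
    have [measurable]: "bad n \<in> sets P" for n unfolding bad_def cnt_def by measurable
    have bound: "prob (bad (Suc n)) \<le> exp c * exp (- c) ^ n" for n
    proof -
      let ?n = "Suc n"
      let ?A = "\<lambda>xs. {\<omega> \<in> space P. \<forall>t\<in>{1..?n}. X t \<omega> = xs t}"
      \<comment> \<open>The exponential tilt is treated as an emission, which turns the exponential
        moment of the visit count into a \<open>lik\<close>.\<close>
      let ?e = "\<lambda>t j. if j = x then exp (- 1) else 1 :: real"
      let ?J = "{xs \<in> paths ?n. cnt ?n xs < c * real ?n}"
      have fin: "finite (paths ?n)" by (intro finite_PiE) auto
      have "AE \<omega> in P. \<omega> \<in> bad ?n \<longrightarrow> \<omega> \<in> (\<Union>xs\<in>?J. ?A xs)"
        using AE_X_path
      proof eventually_elim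
        case (elim \<omega>)
        let ?xs = "restrict (\<lambda>t. X t \<omega>) {1..?n}"
        have "?xs \<in> paths ?n" using elim by blast
        moreover have "cnt ?n ?xs = cnt ?n (\<lambda>t. X t \<omega>)" unfolding cnt_def by (intro sum.cong) auto
        ultimately show ?case by (auto simp: bad_def intro!: exI[of _ ?xs])
      qed
      then have "prob (bad ?n) \<le> prob (\<Union>xs\<in>?J. ?A xs)"
        by (intro finite_measure_mono_AE) (use fin in \<open>auto intro!: sets.finite_UN\<close>)
      also have "\<dots> \<le> (\<Sum>xs\<in>?J. prob (?A xs))"
        by (intro measure_UNION_le) (use fin in auto)
      also have "\<dots> = (\<Sum>xs\<in>?J. path_weight ?n xs)" by (intro sum.cong refl prob_path) auto
      also have "\<dots> \<le> (\<Sum>xs\<in>?J. path_weight ?n xs * exp (c * real ?n - cnt ?n xs))"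
      proof (intro sum_mono)
        fix xs assume xs: "xs \<in> ?J"
        then have "0 \<le> path_weight ?n xs" by (intro path_weight_nonneg) auto
        then show "path_weight ?n xs \<le> path_weight ?n xs * exp (c * real ?n - cnt ?n xs)"
          using xs mult_left_mono[of 1 "exp (c * real ?n - cnt ?n xs)" "path_weight ?n xs"] by simp
      qed
      also have "\<dots> \<le> (\<Sum>xs\<in>paths ?n. path_weight ?n xs * exp (c * real ?n - cnt ?n xs))"
        by (intro sum_mono2 fin mult_nonneg_nonneg path_weight_nonneg) auto
      also have "\<dots> = (\<Sum>xs\<in>paths ?n. exp (c * real ?n) * (path_weight ?n xs * (\<Prod>t\<in>{1..?n}. ?e t (xs t))))"
      proof (intro sum.cong refl)
        fix xs
        have "exp (- cnt ?n xs) = (\<Prod>t\<in>{1..?n}. ?e t (xs t))"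
          unfolding cnt_def sum_negf[symmetric] exp_sum[OF finite_atLeastAtMost] by (intro prod.cong) auto
        moreover have "exp (c * real ?n - cnt ?n xs) = exp (c * real ?n) * exp (- cnt ?n xs)"
          by (simp add: exp_diff exp_minus field_simps)
        ultimately show "path_weight ?n xs * exp (c * real ?n - cnt ?n xs)
            = exp (c * real ?n) * (path_weight ?n xs * (\<Prod>t\<in>{1..?n}. ?e t (xs t)))" by (simp only: mult_ac)
      qed
      also have "\<dots> = exp (c * real ?n) * lik {1..k} p Q ?e ?n" by (simp add: lik_def sum_distrib_left)
      \<comment> \<open>The initial law may avoid \<open>x\<close>, so time 1 only gets the factor
        1; each later time follows a transition and gets \<open>\<rho>\<close>.\<close>
      also have "lik {1..k} p Q ?e ?n \<le> (\<Prod>t\<in>{1..?n}. if t = 1 then 1 else \<rho>)"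
      proof (rule lik_le_prod)
        have "(\<Sum>j\<in>{1..k}. p j * ?e 1 j) \<le> (\<Sum>j\<in>{1..k}. p j)"
          by (intro sum_mono) (use p_nonneg in \<open>auto intro!: mult_left_le\<close>)
        then show "(\<Sum>j\<in>{1..k}. p j * ?e 1 j) \<le> (if 1 = (1::nat) then 1 else \<rho>)" using p_sum by simp
        fix t i assume i: "i \<in> {1..k}" and t: "t \<in> {2..?n}"
        have "(\<Sum>j\<in>{1..k}. Q i j * ?e t j) = (\<Sum>j\<in>{1..k}. Q i j - (if j = x then Q i x * (1 - exp (- 1)) else 0))"
          by (intro sum.cong refl) (auto simp: algebra_simps)
        also have "\<dots> = 1 - Q i x * (1 - exp (- 1))" using Q_sum[OF i] x by (simp add: sum_subtractf)
        also have "\<dots> \<le> \<rho>" unfolding \<rho>_def using Q_ge[OF i x] e1 by (simp add: mult_right_mono)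
        finally show "(\<Sum>j\<in>{1..k}. Q i j * ?e t j) \<le> (if t = 1 then 1 else \<rho>)" using t by simp
      qed (use p_nonneg Q_nonneg \<rho> in auto)
      also have "(\<Prod>t\<in>{1..?n}. if t = 1 then 1 else \<rho>) = \<rho> ^ n"
      proof -
        have "(\<Prod>t\<in>{1..?n}. if t = 1 then 1 else \<rho>) = (\<Prod>t\<in>{2..?n}. \<rho>)"
          by (rule prod.mono_neutral_cong_right) auto
        then show ?thesis by simp
      qed
      also have "exp (c * real ?n) * \<rho> ^ n = exp c * exp (- c) ^ n"
        unfolding \<rho>_eq by (simp add: exp_of_nat_mult[symmetric] exp_add[symmetric] algebra_simps)
      finally show ?thesis by simp
    qed
    have "summable (\<lambda>n. exp c * exp (- c) ^ n)" using c by (intro summable_mult summable_geometric) auto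
    then have "summable (\<lambda>n. prob (bad (Suc n)))"
      by (rule summable_comparison_test') (use bound in auto)
    then have "AE \<omega> in P. eventually (\<lambda>n. \<omega> \<in> space P - bad (Suc n)) sequentially"
      by (intro borel_cantelli_AE1) (auto simp: emeasure_eq_measure)
    then show ?thesis
    proof eventually_elim
      case (elim \<omega>)
      then have "eventually (\<lambda>n. c * real (Suc n) \<le> real (card {t\<in>{1..Suc n}. X t \<omega> = x})) sequentially"
        by eventually_elim (auto simp: bad_def cnt_card)
      then show ?case by (subst (asm) eventually_sequentially_Suc)
    qed
  qed
  with c show thesis by (rule that)
qed

end

section \<open>Likelihoods under an envelope of densities\<close>

lemma ThetaD:
  assumes "\<theta> \<in> Theta K d \<sigma> \<Gamma>"
  shows "1 \<le> Kp \<theta>" "Kp \<theta> \<le> K" "(\<Sum>i\<in>{1..Kp \<theta>}. pip \<theta> i) = 1"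
    "\<And>i. i \<in> {1..Kp \<theta>} \<Longrightarrow> 0 \<le> pip \<theta> i"
    "\<And>i j. i \<in> {1..Kp \<theta>} \<Longrightarrow> j \<in> {1..Kp \<theta>} \<Longrightarrow> \<sigma> \<le> Qp \<theta> i j"
    "\<And>i. i \<in> {1..Kp \<theta>} \<Longrightarrow> (\<Sum>j\<in>{1..Kp \<theta>}. Qp \<theta> i j) = 1"
    "\<And>x. x \<in> {1..Kp \<theta>} \<Longrightarrow> gam \<theta> x \<in> \<Gamma>"
    "\<And>x. x \<in> {1..Kp \<theta>} \<Longrightarrow> degree (Tp \<theta> x) \<le> d"
  using assms by (auto simp: Theta_def prob_vec_def stoch_mat_lb_def)

definition emission :: "hmm_param \<Rightarrow> (nat \<Rightarrow> real) \<Rightarrow> nat \<Rightarrow> nat \<Rightarrow> real" where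
  "emission \<theta> y t j = gam \<theta> j (y t - poly (Tp \<theta> j) (real t))"

definition likelihood :: "hmm_param \<Rightarrow> nat \<Rightarrow> (nat \<Rightarrow> real) \<Rightarrow> real" where
  "likelihood \<theta> n y = lik {1..Kp \<theta>} (pip \<theta>) (Qp \<theta>) (emission \<theta> y) n"

lemma loglik_eq: "loglik \<theta> n y = ln (likelihood \<theta> n y)"
  by (simp add: loglik_def likelihood_def lik_def emission_def)

lemma bij_betw_skip:
  assumes "x \<in> {1..k}"
  shows "bij_betw (\<lambda>i. if i < x then i else Suc i) {1..k - 1} ({1..k} - {x})"
  by (rule bij_betw_byWitness[where f' = "\<lambda>i. if i < x then i else i - 1"]) (use assms in auto)

lemma sup_norm_on_leI:
  "(\<And>s. s \<in> {0..real n} \<Longrightarrow> \<bar>f s\<bar> \<le> M) \<Longrightarrow> sup_norm_on n f \<le> M"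
  unfolding sup_norm_on_def by (intro cSUP_least) auto

lemma abs_poly_le_sup_norm_on:
  assumes "s \<in> {0..real n}"
  shows "\<bar>poly q s\<bar> \<le> sup_norm_on n (poly q)"
proof -
  have "compact ((\<lambda>s. \<bar>poly q s\<bar>) ` {0..real n})"
    by (intro compact_continuous_image continuous_intros) auto
  then have "bdd_above ((\<lambda>s. \<bar>poly q s\<bar>) ` {0..real n})"
    by (intro bounded_imp_bdd_above compact_imp_bounded)
  then show ?thesis unfolding sup_norm_on_def using assms by (intro cSUP_upper) auto
qed

text \<open>Contrapositive of \<open>poly_bound_from_dense_set\<close> with
  \<open>M = C * D\<close>. \<open>M\<close> and \<open>n0\<close> do not depend on the polynomial,
  so they can be fixed before any parameter is considered.\<close>

lemma far_polys_rarely_close: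
  assumes "0 < \<delta>"
  obtains M n0 where "\<And>n q. n \<ge> n0 \<Longrightarrow> degree q \<le> d \<Longrightarrow> \<not> sup_norm_on n (poly q) \<le> M
    \<Longrightarrow> real (card {t\<in>{1..n}. \<bar>poly q (real t)\<bar> \<le> D}) < \<delta> * real n"
proof -
  obtain C n0 where raw: "\<forall>n\<ge>n0. \<forall>(p :: real poly) D T. degree p \<le> d \<longrightarrow> T \<subseteq> {1..n}
      \<longrightarrow> \<delta> * real n \<le> real (card T) \<longrightarrow> (\<forall>t\<in>T. \<bar>poly p (real t)\<bar> \<le> D) \<longrightarrow> (\<forall>s\<in>{0..real n}. \<bar>poly p s\<bar> \<le> C * D)"
    using poly_bound_from_dense_set[OF assms, of d] by (elim exE conjE)
  have C: "\<And>n (q :: real poly) D T s. n \<ge> n0 \<Longrightarrow> degree q \<le> d \<Longrightarrow> T \<subseteq> {1..n}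
      \<Longrightarrow> \<delta> * real n \<le> real (card T) \<Longrightarrow> (\<forall>t\<in>T. \<bar>poly q (real t)\<bar> \<le> D) \<Longrightarrow> s \<in> {0..real n}
      \<Longrightarrow> \<bar>poly q s\<bar> \<le> C * D"
    by (rule raw[rule_format]) auto
  show thesis
  proof (rule that[of n0 "C * D"], rule ccontr)
    fix n and q :: "real poly"
    assume H: "n0 \<le> n" "degree q \<le> d" "\<not> sup_norm_on n (poly q) \<le> C * D"
      "\<not> real (card {t\<in>{1..n}. \<bar>poly q (real t)\<bar> \<le> D}) < \<delta> * real n"
    have "sup_norm_on n (poly q) \<le> C * D"
      by (intro sup_norm_on_leI C[OF H(1,2), of "{t\<in>{1..n}. \<bar>poly q (real t)\<bar> \<le> D}"]) (use H(4) in auto)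
    with H(3) show False by contradiction
  qed
qed

locale density_envelope =
  fixes \<Gamma> :: "(real \<Rightarrow> real) set" and g m :: "real \<Rightarrow> real"
  assumes lower: "\<gamma> \<in> \<Gamma> \<Longrightarrow> m \<bar>z\<bar> \<le> \<gamma> z" and upper: "\<gamma> \<in> \<Gamma> \<Longrightarrow> \<gamma> z \<le> g \<bar>z\<bar>"
    and m_pos: "0 \<le> r \<Longrightarrow> 0 < m r"
    and m_antimono: "0 \<le> r \<Longrightarrow> r \<le> s \<Longrightarrow> m s \<le> m r"
    and g_antimono: "0 \<le> r \<Longrightarrow> r \<le> s \<Longrightarrow> g s \<le> g r"
    and g_tendsto: "(g \<longlongrightarrow> 0) at_top"
begin

lemma measurable_m_abs:
  assumes "0 \<le> c"
  shows "(\<lambda>z. m (c + \<bar>z\<bar>)) \<in> borel_measurable borel"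
proof -
  \<comment> \<open>Monotonicity gives measurability, but \<open>m\<close> is controlled on the
    half-line only; \<open>max 0\<close> extends it to a monotone function on the whole
    line.\<close>
  have "mono (\<lambda>r. - m (max 0 r))" by (intro monoI) (simp add: m_antimono)
  then have [measurable]: "(\<lambda>r. - m (max 0 r)) \<in> borel_measurable borel" by (rule borel_measurable_mono)
  have "(\<lambda>z. - (- m (max 0 (c + \<bar>z\<bar>)))) \<in> borel_measurable borel" by measurable
  then show ?thesis using assms by (simp add: max_def)
qed

lemma dens_pos: "\<gamma> \<in> \<Gamma> \<Longrightarrow> 0 < \<gamma> z"
  using m_pos[of "\<bar>z\<bar>"] lower[of \<gamma> z] by simp

lemma emission_pos: "\<theta> \<in> Theta K d \<sigma> \<Gamma> \<Longrightarrow> j \<in> {1..Kp \<theta>} \<Longrightarrow> 0 < emission \<theta> y t j"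
  unfolding emission_def by (intro dens_pos ThetaD)

lemma emission_le:
  assumes "\<theta> \<in> Theta K d \<sigma> \<Gamma>" "j \<in> {1..Kp \<theta>}" "0 \<le> r" "r \<le> \<bar>y t - poly (Tp \<theta> j) (real t)\<bar>"
  shows "emission \<theta> y t j \<le> g r"
  unfolding emission_def using upper[OF ThetaD(7)[OF assms(1,2)]] g_antimono[OF assms(3,4)] by (rule order_trans)

lemma emission_ge:
  assumes "\<theta> \<in> Theta K d \<sigma> \<Gamma>" "j \<in> {1..Kp \<theta>}" "\<bar>y t - poly (Tp \<theta> j) (real t)\<bar> \<le> r"
  shows "m r \<le> emission \<theta> y t j"
  unfolding emission_def using m_antimono[OF abs_ge_zero assms(3)] lower[OF ThetaD(7)[OF assms(1,2)]] by (rule order_trans)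

text \<open>Some initial weight is positive, and the constant path in that state has positive
  weight. This lets inequalities pass between likelihoods and their logarithms.\<close>

lemma likelihood_pos:
  assumes \<theta>: "\<theta> \<in> Theta K d \<sigma> \<Gamma>" and \<sigma>: "0 < \<sigma>" and n: "1 \<le> n"
  shows "0 < likelihood \<theta> n y"
proof -
  obtain l where l: "n = Suc l" using n by (cases n) auto
  have "\<exists>i\<in>{1..Kp \<theta>}. pip \<theta> i \<noteq> 0" using ThetaD(3)[OF \<theta>] by (metis sum.neutral zero_neq_one)
  then obtain i where i: "i \<in> {1..Kp \<theta>}" "0 < pip \<theta> i" using ThetaD(4)[OF \<theta>] by force
  have "0 < pip \<theta> i * \<sigma> ^ l * (\<Prod>t\<in>{1..Suc l}. emission \<theta> y t i)"
    using i \<sigma> emission_pos[OF \<theta> i(1)] by (intro mult_pos_pos prod_pos) auto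
  also have "\<dots> \<le> likelihood \<theta> n y"
    unfolding likelihood_def l
    by (rule lik_ge_path[where xs = "\<lambda>_. i"])
      (use ThetaD[OF \<theta>] emission_pos[OF \<theta>] i \<sigma> in \<open>auto intro: less_imp_le\<close>)
  finally show ?thesis .
qed

text \<open>Each step averages the emissions over a probability vector, so it contributes at most
  the worst one: \<open>b\<close> at the times in \<open>A\<close> and \<open>G\<close> elsewhere.
  As \<open>b \<le> 1\<close>, a lower bound on the size of \<open>A\<close> suffices.\<close>

lemma likelihood_le_exp:
  assumes \<theta>: "\<theta> \<in> Theta K d \<sigma> \<Gamma>" and \<sigma>: "0 < \<sigma>" and n: "1 \<le> n"
    and G: "1 \<le> G" "g 0 \<le> G" and b: "0 < b" "b \<le> 1"
    and good: "A \<subseteq> {1..n}" "\<And>t j. t \<in> A \<Longrightarrow> j \<in> {1..Kp \<theta>} \<Longrightarrow> emission \<theta> y t j \<le> b"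
      "\<kappa> * real n \<le> real (card A)"
  shows "likelihood \<theta> n y \<le> exp (real n * (ln G + \<kappa> * ln b))"
proof -
  obtain l where l: "n = Suc l" using n by (cases n) auto
  let ?b = "\<lambda>t. if t \<in> A then b else G"
  have e: "emission \<theta> y t j \<le> ?b t" if "j \<in> {1..Kp \<theta>}" for t j
    using good(2)[of t j] that emission_le[OF \<theta> that, of 0 y t] G by auto
  have avg: "(\<Sum>j\<in>{1..Kp \<theta>}. q j * emission \<theta> y t j) \<le> ?b t"
    if "\<And>j. j \<in> {1..Kp \<theta>} \<Longrightarrow> 0 \<le> q j" "(\<Sum>j\<in>{1..Kp \<theta>}. q j) = 1" for q t
  proof -
    have "(\<Sum>j\<in>{1..Kp \<theta>}. q j * emission \<theta> y t j) \<le> (\<Sum>j\<in>{1..Kp \<theta>}. q j * ?b t)"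
      by (intro sum_mono mult_left_mono e that)
    also have "\<dots> = ?b t" by (simp only: sum_distrib_right[symmetric] that(2) mult_1_left)
    finally show ?thesis .
  qed
  have Q0: "0 \<le> Qp \<theta> i j" if "i \<in> {1..Kp \<theta>}" "j \<in> {1..Kp \<theta>}" for i j
    using ThetaD(5)[OF \<theta> that] \<sigma> by simp
  have "likelihood \<theta> n y \<le> (\<Prod>t\<in>{1..n}. ?b t)"
    unfolding likelihood_def l
    by (rule lik_le_prod)
      (use ThetaD[OF \<theta>] Q0 avg emission_pos[OF \<theta>] b G in \<open>auto intro: less_imp_le\<close>)
  also have "\<dots> = exp (\<Sum>t\<in>{1..n}. ln (?b t))"
    unfolding exp_sum[OF finite_atLeastAtMost] using b G by (intro prod.cong) auto
  also have "\<dots> \<le> exp (real n * (ln G + \<kappa> * ln b))"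
  proof -
    have "(\<Sum>t\<in>{1..n}. ln (?b t)) \<le> (\<Sum>t\<in>{1..n}. ln G + (if t \<in> A then ln b else 0))"
      using G by (intro sum_mono) auto
    also have "\<dots> = real n * ln G + real (card A) * ln b"
      using good(1) by (simp add: sum.distrib sum.If_cases Int_absorb1)
    also have "\<dots> \<le> real n * ln G + (\<kappa> * real n) * ln b"
      using good(3) b by (intro add_left_mono mult_right_mono_neg) auto
    finally show ?thesis by (simp add: algebra_simps)
  qed
  finally show ?thesis .
qed

text \<open>Deleting state \<open>x\<close> and renormalizing multiplies every other transition probability by at least
  \<open>1 / (1 - \<sigma>)\<close>; a visit to \<open>x\<close> at time \<open>t\<close> is rerouted through the state \<open>x' t\<close>.\<close>

lemma ex_delete_component:
  assumes \<theta>: "\<theta> \<in> Theta K d \<sigma> \<Gamma>" and \<sigma>: "0 < \<sigma>" "\<sigma> < 1" and x: "x \<in> {1..Kp \<theta>}"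
    and x': "\<And>t. x' t \<in> {1..Kp \<theta>} - {x}"
  shows "\<exists>\<theta>'\<in>Theta K d \<sigma> \<Gamma>. likelihood \<theta> (Suc n) y \<le> real K * (1 - \<sigma>) ^ n
    * (\<Prod>t\<in>{1..Suc n}. 1 + (1 / \<sigma> / (1 - \<sigma>))\<^sup>2 * (emission \<theta> y t x / emission \<theta> y t (x' t)))
    * likelihood \<theta>' (Suc n) y"
proof -
  let ?S = "{1..Kp \<theta>}" and ?f = "\<lambda>i. if i < x then i else Suc i"
  define k' where "k' = Kp \<theta> - 1"
  note bij = bij_betw_skip[OF x, folded k'_def]
  have f: "i \<in> {1..k'} \<Longrightarrow> ?f i \<in> ?S - {x}" for i using bij_betw_apply[OF bij] by blast
  have k': "1 \<le> k'" using x'[of 0] x unfolding k'_def by auto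
  \<comment> \<open>The initial law cannot be renormalized, since all its mass may sit on
    \<open>x\<close>. The uniform law dominates every initial weight up to the factor
    \<open>K\<close>.\<close>
  define p' where "p' i = 1 / real k'" for i :: nat
  define Q' where "Q' i j = Qp \<theta> i j / (1 - Qp \<theta> i x)" for i j
  have Q0: "0 \<le> Qp \<theta> i j" if "i \<in> ?S" "j \<in> ?S" for i j
    using ThetaD(5)[OF \<theta> that] \<sigma> by simp
  have Q_rest: "(\<Sum>j\<in>?S - {x}. Qp \<theta> i j) = 1 - Qp \<theta> i x" if "i \<in> ?S" for i
    using ThetaD(6)[OF \<theta> that] x by (simp add: sum_diff1)
  have Q_le: "Qp \<theta> i j \<le> 1" if "i \<in> ?S" "j \<in> ?S" for i j
    using member_le_sum[of j ?S "Qp \<theta> i"] Q0 that ThetaD(6)[OF \<theta> that(1)] by auto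
  \<comment> \<open>The mass left after removing \<open>x\<close> is at least
    \<open>\<sigma>\<close> because another state, here \<open>x' 0\<close>, remains.\<close>
  have den: "\<sigma> \<le> 1 - Qp \<theta> i x" "1 - Qp \<theta> i x \<le> 1 - \<sigma>" if i: "i \<in> ?S" for i
  proof -
    have "Qp \<theta> i (x' 0) \<le> (\<Sum>j\<in>?S - {x}. Qp \<theta> i j)"
      using x'[of 0] Q0 i by (intro member_le_sum) auto
    then show "\<sigma> \<le> 1 - Qp \<theta> i x" using Q_rest[OF i] ThetaD(5)[OF \<theta> i, of "x' 0"] x'[of 0] by simp
    show "1 - Qp \<theta> i x \<le> 1 - \<sigma>" using ThetaD(5)[OF \<theta> i x] by simp
  qed
  have Q'_ge: "\<sigma> \<le> Q' i j" if "i \<in> ?S" "j \<in> ?S" for i j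
  proof -
    have "\<sigma> * (1 - Qp \<theta> i x) \<le> Qp \<theta> i j * 1"
      using ThetaD(5)[OF \<theta> that] Q0 that x \<sigma> den[OF that(1)] by (intro mult_mono) auto
    then show ?thesis unfolding Q'_def using den[OF that(1)] \<sigma> by (simp add: field_simps)
  qed
  define \<theta>' where "\<theta>' = \<lparr>Kp = k', pip = p' \<circ> ?f, Qp = \<lambda>i j. Q' (?f i) (?f j),
    gam = \<lambda>i. gam \<theta> (?f i), Tp = \<lambda>i. Tp \<theta> (?f i)\<rparr>"
  have sel: "Kp \<theta>' = k'" "pip \<theta>' = p' \<circ> ?f" "Qp \<theta>' = (\<lambda>i j. Q' (?f i) (?f j))"
    "gam \<theta>' = (\<lambda>i. gam \<theta> (?f i))" "Tp \<theta>' = (\<lambda>i. Tp \<theta> (?f i))"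
    by (simp_all add: \<theta>'_def)
  have "\<theta>' \<in> Theta K d \<sigma> \<Gamma>"
    unfolding Theta_def mem_Collect_eq prob_vec_def stoch_mat_lb_def sel
  proof (intro conjI ballI)
    show "k' \<le> K" using ThetaD(2)[OF \<theta>] by (simp add: k'_def)
    show "(\<Sum>i\<in>{1..k'}. (p' \<circ> ?f) i) = 1" using k' by (simp add: p'_def)
  next
    fix i assume i: "i \<in> {1..k'}"
    have "(\<Sum>j\<in>{1..k'}. Q' (?f i) (?f j)) = (\<Sum>j\<in>?S - {x}. Q' (?f i) j)"
      by (rule sum.reindex_bij_betw[OF bij])
    also have "\<dots> = (1 - Qp \<theta> (?f i) x) / (1 - Qp \<theta> (?f i) x)"
      unfolding Q'_def sum_divide_distrib[symmetric] by (subst Q_rest) (use f[OF i] in blast)+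
    also have "\<dots> = 1"
    proof -
      have "\<sigma> \<le> 1 - Qp \<theta> (?f i) x" by (rule den) (use f[OF i] in blast)
      then show ?thesis using \<sigma>(1) by (intro divide_self) linarith
    qed
    finally show "(\<Sum>j\<in>{1..k'}. Q' (?f i) (?f j)) = 1" .
    show "gam \<theta> (?f i) \<in> \<Gamma>" "degree (Tp \<theta> (?f i)) \<le> d"
      by (intro ThetaD[OF \<theta>]; use f[OF i] in blast)+
    fix j assume j: "j \<in> {1..k'}"
    show "\<sigma> \<le> Q' (?f i) (?f j)" using Q'_ge f[OF i] f[OF j] by blast
  qed (use k' in \<open>simp_all add: p'_def\<close>)
  moreover have "likelihood \<theta>' (Suc n) y = lik (?S - {x}) p' Q' (emission \<theta> y) (Suc n)"
    unfolding likelihood_def sel using lik_reindex[OF bij, of p' Q' "emission \<theta> y" n]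
    by (simp add: emission_def[abs_def] sel)
  moreover have "lik ?S (pip \<theta>) (Qp \<theta>) (emission \<theta> y) (Suc n) \<le> real K * (1 - \<sigma>) ^ n
    * (\<Prod>t\<in>{1..Suc n}. 1 + (1 / \<sigma> / (1 - \<sigma>))\<^sup>2 * (emission \<theta> y t x / emission \<theta> y t (x' t)))
    * lik (?S - {x}) p' Q' (emission \<theta> y) (Suc n)"
  \<comment> \<open>Here \<open>\<alpha> = 1 - \<sigma>\<close> is the gain of renormalization, and
    \<open>\<beta> = 1 / \<sigma>\<close> compares arbitrary transitions, at most 1 before and at
    least \<open>\<sigma>\<close> after the deletion.\<close>
  proof (rule lik_delete_state)
    fix i i' assume i: "i \<in> ?S" "i' \<in> ?S - {x}"
    have "pip \<theta> i \<le> 1" using member_le_sum[of i ?S "pip \<theta>"] ThetaD(3,4)[OF \<theta>] i by auto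
    also have "1 \<le> real K * p' i'" using k' ThetaD(2)[OF \<theta>] by (simp add: p'_def k'_def field_simps)
    finally show "pip \<theta> i \<le> real K * p' i'" .
  next
    fix i j assume ij: "i \<in> ?S - {x}" "j \<in> ?S - {x}"
    then have ij': "i \<in> ?S" "j \<in> ?S" by auto
    show "0 \<le> Q' i j" using Q'_ge[OF ij'] \<sigma> by simp
    have "Qp \<theta> i j * (1 - Qp \<theta> i x) \<le> Qp \<theta> i j * (1 - \<sigma>)"
      using den[OF ij'(1)] Q0[OF ij'] by (intro mult_left_mono) auto
    then show "Qp \<theta> i j \<le> (1 - \<sigma>) * Q' i j"
      unfolding Q'_def using den(1)[OF ij'(1)] \<sigma> by (simp add: field_simps)
  next
    fix i j i' j' assume ij: "i \<in> ?S" "j \<in> ?S" "i' \<in> ?S - {x}" "j' \<in> ?S - {x}"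
    have "Qp \<theta> i j \<le> 1" by (rule Q_le[OF ij(1,2)])
    also have "1 \<le> 1 / \<sigma> * Q' i' j'" using Q'_ge[of i' j'] ij \<sigma> by (simp add: field_simps)
    finally show "Qp \<theta> i j \<le> 1 / \<sigma> * Q' i' j'" .
  next
    fix t
    have pos: "0 < emission \<theta> y t (x' t)" "0 < emission \<theta> y t x" using emission_pos[OF \<theta>] x' x by auto
    then show "emission \<theta> y t x \<le> emission \<theta> y t x / emission \<theta> y t (x' t) * emission \<theta> y t (x' t)"
      "0 \<le> emission \<theta> y t x / emission \<theta> y t (x' t)" by simp_all
  next
    show "0 \<le> emission \<theta> y t j" if "j \<in> ?S" for t j using emission_pos[OF \<theta> that] by (rule less_imp_le)
  qed (use x x' \<sigma> Q0 ThetaD(4)[OF \<theta>] in \<open>simp_all add: p'_def\<close>)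
  ultimately show ?thesis unfolding likelihood_def[of \<theta>] by (intro bexI[of _ \<theta>']) simp_all
qed

end

section \<open>Localization of the maximum likelihood estimator\<close>

text \<open>Dominated convergence. With \<open>F = 1\<close> it makes times of large noise rare;
  with a logarithmic \<open>F\<close> it makes their total cost small.\<close>

lemma (in prob_space) eventually_tail_expectation_less:
  fixes F W :: "'a \<Rightarrow> real"
  assumes F: "integrable M F" and W[measurable]: "W \<in> borel_measurable M" and \<eta>: "0 < \<eta>"
  shows "eventually (\<lambda>A::nat. expectation (\<lambda>\<omega>. if real A < \<bar>W \<omega>\<bar> then F \<omega> else 0) < \<eta>) sequentially"
proof -
  have [measurable]: "F \<in> borel_measurable M" using F by auto
  have "(\<lambda>A::nat. expectation (\<lambda>\<omega>. if real A < \<bar>W \<omega>\<bar> then F \<omega> else 0)) \<longlonglongrightarrow> expectation (\<lambda>_. 0)"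
  proof (rule integral_dominated_convergence[where w = "\<lambda>\<omega>. \<bar>F \<omega>\<bar>"])
    show "AE \<omega> in M. (\<lambda>A::nat. if real A < \<bar>W \<omega>\<bar> then F \<omega> else 0) \<longlonglongrightarrow> 0"
    proof (intro AE_I2 tendsto_eventually)
      fix \<omega>
      show "eventually (\<lambda>A::nat. (if real A < \<bar>W \<omega>\<bar> then F \<omega> else 0) = 0) sequentially"
        using eventually_ge_at_top[of "nat \<lceil>\<bar>W \<omega>\<bar>\<rceil>"]
      proof eventually_elim
        case (elim A)
        then have "\<not> real A < \<bar>W \<omega>\<bar>" by linarith
        then show ?case by simp
      qed
    qed
  qed (use F in auto)
  then show ?thesis using \<eta> by (auto dest: order_tendstoD(2))
qed

locale hmm_trend = hmm_data P X Z "Kp \<theta>s" "pip \<theta>s" "Qp \<theta>s" \<sigma> "gam \<theta>s" + density_envelope \<Gamma> g m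
  for P :: "'w measure" and X Z and \<theta>s :: hmm_param and \<sigma> \<Gamma> g m +
  fixes K d :: nat
  assumes \<theta>s: "\<theta>s \<in> Theta K d \<sigma> \<Gamma>"
    and log_int: "x \<in> {1..Kp \<theta>s} \<Longrightarrow> 0 < c \<Longrightarrow> integrable P (\<lambda>\<omega>. max 0 (- ln (m (c + \<bar>Z x 1 \<omega>\<bar>))))"
begin

abbreviation "S \<equiv> {1..Kp \<theta>s}"

definition obs :: "'w \<Rightarrow> nat \<Rightarrow> real" where
  "obs \<omega> t = Z (X t \<omega>) t \<omega> + poly (Tp \<theta>s (X t \<omega>)) (real t)"

lemma obs_minus_trend:
  "obs \<omega> t - poly q (real t) = Z (X t \<omega>) t \<omega> + poly (Tp \<theta>s (X t \<omega>) - q) (real t)"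
  by (simp add: obs_def)

text \<open>The noise selected by the chain is dominated by the noise of all components together,
  and each component obeys the law of large numbers by itself.\<close>

lemma sum_selected_le:
  assumes "\<And>z. 0 \<le> F z" "\<And>t. t \<ge> 1 \<Longrightarrow> X t \<omega> \<in> S"
  shows "(\<Sum>t\<in>{1..n}. F (Z (X t \<omega>) t \<omega>)) \<le> (\<Sum>x\<in>S. \<Sum>t\<in>{1..n}. F (Z x t \<omega>) :: real)"
proof -
  have "(\<Sum>t\<in>{1..n}. F (Z (X t \<omega>) t \<omega>)) \<le> (\<Sum>t\<in>{1..n}. \<Sum>x\<in>S. F (Z x t \<omega>))"
    using assms by (intro sum_mono member_le_sum[of _ S "\<lambda>x. F (Z x _ \<omega>)"]) auto
  then show ?thesis by (subst sum.swap)
qed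

text \<open>The realised hidden path alone carries enough likelihood: along it the residuals are the
  noise itself.\<close>

lemma ex_loglik_true_ge:
  "\<exists>C0. AE \<omega> in P. eventually (\<lambda>n. - C0 * real n \<le> ln (likelihood \<theta>s n (obs \<omega>))) sequentially"
proof -
  \<comment> \<open>The shift 1 appears because the logarithmic moment is available at positive
    shifts only.\<close>
  let ?h = "\<lambda>z. max 0 (- ln (m (1 + \<bar>z\<bar>)))"
  note [measurable] = measurable_m_abs[OF zero_le_one]
  define C where "C x = 2 * expectation (\<lambda>\<omega>. ?h (Z x 1 \<omega>)) + 1" for x
  have "AE \<omega> in P. \<forall>x\<in>S. eventually (\<lambda>n. (\<Sum>t\<in>{1..n}. ?h (Z x t \<omega>)) \<le> C x * real n) sequentially"
  proof (subst AE_ball_countable, simp, intro ballI eventually_sum_Z_le)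
    fix x assume x: "x \<in> S"
    show "integrable P (\<lambda>\<omega>. ?h (Z x 1 \<omega>))" by (rule log_int[OF x]) simp
    show "2 * expectation (\<lambda>\<omega>. ?h (Z x 1 \<omega>)) < C x" by (simp add: C_def)
  qed auto
  with AE_X_in AE_p_X1_pos
  \<comment> \<open>In the constant, 1 absorbs the initial weight, as \<open>n\<close> eventually
    exceeds minus its logarithm; \<open>- ln \<sigma>\<close> pays for the transitions and
    \<open>sum C S\<close> for the emissions.\<close>
  have "AE \<omega> in P. eventually (\<lambda>n. - (1 - ln \<sigma> + sum C S) * real n \<le> ln (likelihood \<theta>s n (obs \<omega>))) sequentially"
  proof eventually_elim
    case (elim \<omega>)
    have X: "X t \<omega> \<in> S" if "t \<ge> 1" for t using elim(1) that by blast
    have "eventually (\<lambda>n. \<forall>x\<in>S. (\<Sum>t\<in>{1..n}. ?h (Z x t \<omega>)) \<le> C x * real n) sequentially"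
      using elim(3) by (intro eventually_ball_finite) auto
    moreover have "eventually (\<lambda>n. real n \<ge> - ln (pip \<theta>s (X 1 \<omega>))) sequentially" by real_asymp
    ultimately show ?case using eventually_ge_at_top[of 1]
    proof eventually_elim
      case (elim n)
      obtain l where l: "n = Suc l" using elim by (cases n) auto
      let ?e = "emission \<theta>s (obs \<omega>)"
      have e: "exp (- ?h (Z (X t \<omega>) t \<omega>)) \<le> ?e t (X t \<omega>)" if "t \<ge> 1" for t
      proof -
        have "exp (- ?h (Z (X t \<omega>) t \<omega>)) \<le> exp (ln (m (1 + \<bar>Z (X t \<omega>) t \<omega>\<bar>)))" by simp
        also have "\<dots> = m (1 + \<bar>Z (X t \<omega>) t \<omega>\<bar>)" by (intro exp_ln m_pos) auto
        also have "\<dots> \<le> ?e t (X t \<omega>)" by (intro emission_ge[OF \<theta>s X[OF that]]) (simp add: obs_def)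
        finally show ?thesis .
      qed
      have "(\<Prod>t\<in>{1..Suc l}. exp (- ?h (Z (X t \<omega>) t \<omega>))) = exp (- (\<Sum>t\<in>{1..Suc l}. ?h (Z (X t \<omega>) t \<omega>)))"
        unfolding sum_negf[symmetric] by (rule exp_sum[symmetric]) simp
      then have "exp (ln (pip \<theta>s (X 1 \<omega>)) + real l * ln \<sigma> - (\<Sum>t\<in>{1..n}. ?h (Z (X t \<omega>) t \<omega>)))
          = pip \<theta>s (X 1 \<omega>) * \<sigma> ^ l * (\<Prod>t\<in>{1..Suc l}. exp (- ?h (Z (X t \<omega>) t \<omega>)))"
        using \<open>0 < pip \<theta>s (X 1 \<omega>)\<close> \<sigma> unfolding l
        by (simp add: exp_add exp_diff exp_of_nat_mult exp_minus divide_inverse del: prod.cl_ivl_Suc sum.cl_ivl_Suc)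
      also have "\<dots> \<le> pip \<theta>s (X 1 \<omega>) * \<sigma> ^ l * (\<Prod>t\<in>{1..Suc l}. ?e t (X t \<omega>))"
        using p_nonneg X \<sigma> e by (intro mult_left_mono prod_mono mult_nonneg_nonneg) auto
      also have "\<dots> \<le> likelihood \<theta>s n (obs \<omega>)"
        unfolding likelihood_def l
        by (rule lik_ge_path[where xs = "\<lambda>t. X t \<omega>"])
          (use p_nonneg \<sigma> Q_ge X in \<open>auto intro: less_imp_le[OF emission_pos[OF \<theta>s]]\<close>)
      finally have "ln (pip \<theta>s (X 1 \<omega>)) + real l * ln \<sigma> - (\<Sum>t\<in>{1..n}. ?h (Z (X t \<omega>) t \<omega>)) \<le> ln (likelihood \<theta>s n (obs \<omega>))"
        by (subst ln_ge_iff) (use elim likelihood_pos[OF \<theta>s \<sigma>(1)] in auto)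
      moreover have "(\<Sum>t\<in>{1..n}. ?h (Z (X t \<omega>) t \<omega>)) \<le> sum C S * real n"
        using sum_selected_le[of ?h \<omega> n] X elim(1) sum_mono[of S "\<lambda>x. \<Sum>t\<in>{1..n}. ?h (Z x t \<omega>)" "\<lambda>x. C x * real n"]
        by (simp add: sum_distrib_right)
      moreover have "real n * ln \<sigma> \<le> real l * ln \<sigma>" using \<sigma> l by (intro mult_right_mono_neg) auto
      ultimately show ?case using elim(2) by (simp add: algebra_simps)
    qed
  qed
  then show ?thesis by blast
qed

lemma ex_true_components_covered:
  "\<exists>M>0. AE \<omega> in P. eventually (\<lambda>n. \<forall>\<theta>\<in>Theta K d \<sigma> \<Gamma>. - C0 * real n \<le> ln (likelihood \<theta> n (obs \<omega>))
    \<longrightarrow> (\<forall>xs\<in>S. \<exists>x\<in>{1..Kp \<theta>}. sup_norm_on n (poly (Tp \<theta>s xs - Tp \<theta> x)) \<le> M)) sequentially"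
proof -
  obtain c where c: "0 < c"
    "\<And>x. x \<in> S \<Longrightarrow> AE \<omega> in P. eventually (\<lambda>n. c * real n \<le> real (card {t\<in>{1..n}. X t \<omega> = x})) sequentially"
    by (rule ex_visit_frequency) blast
  have K: "1 \<le> K" using ThetaD(1,2)[OF \<theta>s] by simp
  have g_pos: "0 < g r" if "0 \<le> r" for r
    using dens_pos[OF ThetaD(7)[OF \<theta>s], of 1 r] upper[OF ThetaD(7)[OF \<theta>s], of 1 r] ThetaD(1)[OF \<theta>s] that by auto
  define G where "G = max 1 (g 0)"
  have G: "1 \<le> G" "g 0 \<le> G" by (auto simp: G_def)
  \<comment> \<open>Solves \<open>ln G + c / 2 * ln b0 = - C0 - 1\<close>, which is strictly below
    \<open>- C0\<close>.\<close>
  define b0 where "b0 = exp (- (C0 + ln G + 1) * (2 / c))"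
  let ?F = "\<lambda>A z. if real A < \<bar>z\<bar> then 1 else 0 :: real"
  \<comment> \<open>The law of large numbers doubles \<open>c / 8\<close>, so large noise spoils at
    most a fraction \<open>c / 4\<close> of the times.\<close>
  have "eventually (\<lambda>A::nat. \<forall>x\<in>S. expectation (\<lambda>\<omega>. ?F A (Z x 1 \<omega>)) < c / 8) sequentially"
    using c(1) by (intro eventually_ball_finite ballI eventually_tail_expectation_less) auto
  moreover have "eventually (\<lambda>A::nat. g (real A) < min 1 b0) sequentially"
    using filterlim_compose[OF g_tendsto filterlim_real_sequentially] by (rule order_tendstoD) (simp add: b0_def)
  ultimately have "eventually (\<lambda>A::nat. (\<forall>x\<in>S. expectation (\<lambda>\<omega>. ?F A (Z x 1 \<omega>)) < c / 8) \<and> g (real A) < min 1 b0) sequentially"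
    by (rule eventually_conj)
  from eventually_happens'[OF sequentially_bot this]
  obtain A :: nat where "(\<forall>x\<in>S. expectation (\<lambda>\<omega>. ?F A (Z x 1 \<omega>)) < c / 8) \<and> g (real A) < min 1 b0" ..
  then have A: "\<And>x. x \<in> S \<Longrightarrow> expectation (\<lambda>\<omega>. ?F A (Z x 1 \<omega>)) < c / 8" "g (real A) < 1" "g (real A) < b0"
    by auto
  \<comment> \<open>At most \<open>K\<close> trends, each close at a fraction
    \<open>\<delta>\<close> of the times, spoil another \<open>c / 4\<close>. Of the visits, a
    fraction \<open>c\<close>, at least \<open>c / 2\<close> remains.\<close>
  define \<delta> where "\<delta> = c / (4 * real K)"
  have \<delta>: "0 < \<delta>" using c K by (simp add: \<delta>_def)
  \<comment> \<open>Trend distance above \<open>2 * A\<close> and noise at most \<open>A\<close>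
    leave a residual of at least \<open>A\<close>.\<close>
  obtain M n0 where M: "\<And>n q. n \<ge> n0 \<Longrightarrow> degree q \<le> d \<Longrightarrow> \<not> sup_norm_on n (poly q) \<le> M
    \<Longrightarrow> real (card {t\<in>{1..n}. \<bar>poly q (real t)\<bar> \<le> 2 * real A}) < \<delta> * real n"
    by (rule far_polys_rarely_close[OF \<delta>, where D = "2 * real A" and d = d]) blast
  have freq: "AE \<omega> in P. \<forall>x\<in>S. eventually (\<lambda>n. c * real n \<le> real (card {t\<in>{1..n}. X t \<omega> = x})) sequentially"
    using c(2) by (subst AE_ball_countable) auto
  have "AE \<omega> in P. \<forall>x\<in>S. eventually (\<lambda>n. (\<Sum>t\<in>{1..n}. ?F A (Z x t \<omega>)) \<le> c / 4 * real n) sequentially"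
  proof (subst AE_ball_countable, simp, intro ballI eventually_sum_Z_le)
    fix x assume x: "x \<in> S"
    show "integrable P (\<lambda>\<omega>. ?F A (Z x 1 \<omega>))" by (rule integrable_const_bound[of _ 1]) auto
    show "2 * expectation (\<lambda>\<omega>. ?F A (Z x 1 \<omega>)) < c / 4" using A(1)[OF x] by simp
  qed auto
  with freq have "AE \<omega> in P. eventually (\<lambda>n. \<forall>\<theta>\<in>Theta K d \<sigma> \<Gamma>. - C0 * real n \<le> ln (likelihood \<theta> n (obs \<omega>))
    \<longrightarrow> (\<forall>xs\<in>S. \<exists>x\<in>{1..Kp \<theta>}. sup_norm_on n (poly (Tp \<theta>s xs - Tp \<theta> x)) \<le> max 1 M)) sequentially"
  proof eventually_elim
    case (elim \<omega>)
    have "eventually (\<lambda>n. \<forall>x\<in>S. c * real n \<le> real (card {t\<in>{1..n}. X t \<omega> = x})) sequentially"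
      "eventually (\<lambda>n. \<forall>x\<in>S. (\<Sum>t\<in>{1..n}. ?F A (Z x t \<omega>)) \<le> c / 4 * real n) sequentially"
      using elim by (auto intro!: eventually_ball_finite)
    with eventually_ge_at_top[of "max 1 n0"] show ?case
    proof eventually_elim
      case (elim n)
      show ?case
      proof (intro ballI impI, rule ccontr)
        fix \<theta> xs
        assume \<theta>: "\<theta> \<in> Theta K d \<sigma> \<Gamma>" and ll: "- C0 * real n \<le> ln (likelihood \<theta> n (obs \<omega>))" and xs: "xs \<in> S"
          and far: "\<not> (\<exists>x\<in>{1..Kp \<theta>}. sup_norm_on n (poly (Tp \<theta>s xs - Tp \<theta> x)) \<le> max 1 M)"
        define visits where "visits = {t\<in>{1..n}. X t \<omega> = xs}"
        define large where "large = {t\<in>{1..n}. real A < \<bar>Z xs t \<omega>\<bar>}"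
        define close where "close x = {t\<in>{1..n}. \<bar>poly (Tp \<theta>s xs - Tp \<theta> x) (real t)\<bar> \<le> 2 * real A}" for x
        define good where "good = visits - (large \<union> (\<Union>x\<in>{1..Kp \<theta>}. close x))"
        have fin: "finite visits" "finite large" "finite (close x)" "finite good" for x
          by (auto simp: visits_def large_def close_def good_def)
        have "real (card (close x)) \<le> \<delta> * real n" if x: "x \<in> {1..Kp \<theta>}" for x
        proof -
          have "\<not> sup_norm_on n (poly (Tp \<theta>s xs - Tp \<theta> x)) \<le> M" using far x by force
          moreover have "degree (Tp \<theta>s xs - Tp \<theta> x) \<le> d"
            by (intro degree_diff_le ThetaD(8)[OF \<theta>s xs] ThetaD(8)[OF \<theta> x])
          ultimately show ?thesis unfolding close_def using M[of n] elim by fastforce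
        qed
        then have "(\<Sum>x\<in>{1..Kp \<theta>}. real (card (close x))) \<le> real (Kp \<theta>) * (\<delta> * real n)"
          using sum_bounded_above[of "{1..Kp \<theta>}" "\<lambda>x. real (card (close x))"] by simp
        also have "\<dots> \<le> real K * (\<delta> * real n)" using ThetaD(2)[OF \<theta>] \<delta> by (intro mult_right_mono) auto
        also have "\<dots> = c / 4 * real n" using K by (simp add: \<delta>_def)
        finally have close: "(\<Sum>x\<in>{1..Kp \<theta>}. real (card (close x))) \<le> c / 4 * real n" .
        have large: "real (card large) \<le> c / 4 * real n"
          using elim(3) xs by (simp add: large_def sum.If_cases Int_def)
        have "card visits \<le> card (good \<union> (large \<union> (\<Union>x\<in>{1..Kp \<theta>}. close x)))"
          by (intro card_mono) (use fin in \<open>auto simp: good_def\<close>)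
        also have "\<dots> \<le> card good + (card large + card (\<Union>x\<in>{1..Kp \<theta>}. close x))"
          using card_Un_le[of good "large \<union> (\<Union>x\<in>{1..Kp \<theta>}. close x)"] card_Un_le[of large "\<Union>x\<in>{1..Kp \<theta>}. close x"] by linarith
        also have "\<dots> \<le> card good + (card large + (\<Sum>x\<in>{1..Kp \<theta>}. card (close x)))"
          by (intro add_left_mono card_UN_le) auto
        finally have "real (card visits) \<le> real (card good) + (real (card large) + (\<Sum>x\<in>{1..Kp \<theta>}. real (card (close x))))"
          by (simp flip: of_nat_sum of_nat_add)
        moreover have "c * real n \<le> real (card visits)" using elim xs by (simp add: visits_def)
        ultimately have good: "c / 2 * real n \<le> real (card good)" using close large by (simp add: field_simps)
        have "likelihood \<theta> n (obs \<omega>) \<le> exp (real n * (ln G + c / 2 * ln (g (real A))))"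
        proof (rule likelihood_le_exp[OF \<theta> \<sigma>(1) _ G _ _ _ _ good])
          fix t j assume t: "t \<in> good" and j: "j \<in> {1..Kp \<theta>}"
          then have "X t \<omega> = xs" "\<bar>Z xs t \<omega>\<bar> \<le> real A" "2 * real A < \<bar>poly (Tp \<theta>s xs - Tp \<theta> j) (real t)\<bar>"
            by (auto simp: good_def visits_def large_def close_def not_less not_le)
          then have "real A \<le> \<bar>obs \<omega> t - poly (Tp \<theta> j) (real t)\<bar>" unfolding obs_minus_trend by auto
          then show "emission \<theta> (obs \<omega>) t j \<le> g (real A)" by (intro emission_le[OF \<theta> j]) auto
        qed (use elim g_pos A in \<open>auto simp: good_def visits_def\<close>)
        then have "ln (likelihood \<theta> n (obs \<omega>)) \<le> real n * (ln G + c / 2 * ln (g (real A)))"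
          using likelihood_pos[OF \<theta> \<sigma>(1), of n "obs \<omega>"] elim by (metis ln_exp ln_le_cancel_iff exp_gt_zero max.bounded_iff)
        also have "ln (g (real A)) < - (C0 + ln G + 1) * (2 / c)"
          using A(3) g_pos[of "real A"] ln_less_cancel_iff[of "g (real A)" b0] by (simp add: b0_def)
        then have "c / 2 * ln (g (real A)) < - (C0 + ln G + 1)" using c(1) by (simp add: field_simps)
        then have "real n * (ln G + c / 2 * ln (g (real A))) < real n * (- C0)" using elim by (intro mult_strict_left_mono) auto
        finally show False using ll by (simp add: mult.commute)
      qed
    qed
  qed
  then show ?thesis by (intro exI[of _ "max 1 M"]) auto
qed

text \<open>The logarithms of the rerouting factors must add up to less than the gain from deleting
  the component. The constants are fixed in the order \<open>A\<close>, \<open>B\<close>,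
  \<open>\<delta>\<close>, \<open>D\<close>, \<open>M\<close>, each depending on earlier ones
  only.\<close>

lemma ex_no_far_component:
  assumes M1: "0 < M1"
  shows "\<exists>M>0. AE \<omega> in P. eventually (\<lambda>n. \<forall>\<theta>\<in>Theta K d \<sigma> \<Gamma>.
      (\<forall>\<theta>'\<in>Theta K d \<sigma> \<Gamma>. likelihood \<theta>' n (obs \<omega>) \<le> likelihood \<theta> n (obs \<omega>))
    \<longrightarrow> (\<forall>xs\<in>S. \<exists>x\<in>{1..Kp \<theta>}. sup_norm_on n (poly (Tp \<theta>s xs - Tp \<theta> x)) \<le> M1)
    \<longrightarrow> (\<forall>x\<in>{1..Kp \<theta>}. \<exists>xs\<in>S. sup_norm_on n (poly (Tp \<theta>s xs - Tp \<theta> x)) \<le> M)) sequentially"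
proof -
  define c where "c = (1 / \<sigma> / (1 - \<sigma>))\<^sup>2"
  have c: "0 < c" using \<sigma> by (simp add: c_def)
  define G where "G = max 1 (g 0)"
  have G: "1 \<le> G" "g 0 \<le> G" by (auto simp: G_def)
  \<comment> \<open>Logarithm of a rerouting bound valid at every time: the far component emits at
    most \<open>G\<close>, its substitute at least \<open>m (M1 + \<bar>z\<bar>)\<close>. The first
    summand makes \<open>H\<close> positive, so that dividing by \<open>B\<close> below is
    legitimate.\<close>
  define H where "H z = ln (1 + c * G) + max 0 (- ln (m (M1 + \<bar>z\<bar>)))" for z
  have lncG: "0 < ln (1 + c * G)" using c G by (intro ln_gt_zero) auto
  have H_pos: "0 < H z" for z using lncG by (simp add: H_def add_pos_nonneg)
  note [measurable] = measurable_m_abs[OF less_imp_le[OF M1]]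
  have [measurable]: "H \<in> borel_measurable borel" unfolding H_def[abs_def] by measurable
  have H_int: "integrable P (\<lambda>\<omega>. H (Z x 1 \<omega>))" if "x \<in> S" for x
    unfolding H_def using log_int[OF that M1] by simp
  have H_mono: "H z \<le> H w" if "\<bar>z\<bar> \<le> \<bar>w\<bar>" for z w
  proof -
    have "ln (m (M1 + \<bar>w\<bar>)) \<le> ln (m (M1 + \<bar>z\<bar>))"
      using m_antimono[of "M1 + \<bar>z\<bar>" "M1 + \<bar>w\<bar>"] m_pos[of "M1 + \<bar>w\<bar>"] m_pos[of "M1 + \<bar>z\<bar>"] M1 that by simp
    then show ?thesis by (simp add: H_def max_def)
  qed
  have H_exp: "1 + c * (G / m (M1 + \<bar>z\<bar>)) \<le> exp (H z)" for z
  proof -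
    let ?u = "m (M1 + \<bar>z\<bar>)"
    have u: "0 < ?u" using M1 by (intro m_pos) auto
    have "exp (- ln ?u) = 1 / ?u" using u by (simp add: exp_minus divide_inverse)
    moreover have "exp (- ln ?u) \<le> exp (max 0 (- ln ?u))" "exp 0 \<le> exp (max 0 (- ln ?u))"
      unfolding exp_le_cancel_iff by auto
    ultimately have "max 1 (1 / ?u) \<le> exp (max 0 (- ln ?u))" by simp
    moreover have "exp (H z) = (1 + c * G) * exp (max 0 (- ln ?u))"
      using c G by (simp add: H_def exp_add add_pos_pos)
    moreover have "1 + c * (G / ?u) \<le> (1 + c * G) * max 1 (1 / ?u)"
    proof -
      have "1 * 1 + c * G * (1 / ?u) \<le> 1 * max 1 (1 / ?u) + c * G * max 1 (1 / ?u)"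
        using c G by (intro add_mono mult_left_mono) auto
      then show ?thesis by (simp add: algebra_simps)
    qed
    ultimately show ?thesis using c G
      by (smt (verit) mult_left_mono mult_nonneg_nonneg)
  qed
  \<comment> \<open>The logarithmic gain per transition.\<close>
  define \<kappa> where "\<kappa> = - ln (1 - \<sigma>)"
  have \<kappa>: "0 < \<kappa>" using \<sigma> by (simp add: \<kappa>_def)
  have k: "1 \<le> Kp \<theta>s" "1 \<le> K" using ThetaD(1,2)[OF \<theta>s] by simp_all
  let ?F = "\<lambda>A z. if real A < \<bar>z\<bar> then H z else 0"
  \<comment> \<open>Summed over the true components, a rate \<open>\<eta>\<close> makes up one
    quarter of the gain. The tail expectation is taken below \<open>\<eta> / 2\<close> to offset the
    factor 2 of the law of large numbers.\<close>
  define \<eta> where "\<eta> = \<kappa> / (4 * real (Kp \<theta>s))"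
  have \<eta>: "0 < \<eta>" using \<kappa> k by (simp add: \<eta>_def)
  have "eventually (\<lambda>A::nat. \<forall>x\<in>S. expectation (\<lambda>\<omega>. ?F A (Z x 1 \<omega>)) < \<eta> / 2) sequentially"
    using \<eta> by (intro eventually_ball_finite ballI eventually_tail_expectation_less H_int) auto
  from eventually_happens'[OF sequentially_bot this]
  obtain A :: nat where A: "\<forall>x\<in>S. expectation (\<lambda>\<omega>. ?F A (Z x 1 \<omega>)) < \<eta> / 2" ..
  \<comment> \<open>The cost of one time with moderate noise but a trend that is not far. With
    \<open>\<delta> = \<eta> / B\<close> such times use up a second quarter.\<close>
  define B where "B = H (real A)"
  have B: "0 < B" by (simp add: B_def H_pos)
  define \<delta> where "\<delta> = \<eta> / B"
  have \<delta>: "0 < \<delta>" using \<eta> B by (simp add: \<delta>_def)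
  have mA: "0 < m (M1 + real A)" using M1 by (intro m_pos) auto
  have "eventually (\<lambda>r. g r < (exp (\<kappa> / 4) - 1) * m (M1 + real A) / c) at_top"
    using g_tendsto by (rule order_tendstoD) (use \<kappa> mA c in auto)
  then obtain D0 where D0: "\<And>r. D0 \<le> r \<Longrightarrow> g r < (exp (\<kappa> / 4) - 1) * m (M1 + real A) / c"
    by (auto simp: eventually_at_top_linorder)
  \<comment> \<open>At a residual of at least \<open>D\<close> the far component emits so little
    that an ordinary time costs at most \<open>\<kappa> / 4\<close>.\<close>
  define D where "D = max 0 D0"
  have D: "0 \<le> D" "1 + c * (g D / m (M1 + real A)) \<le> exp (\<kappa> / 4)"
    using D0[of D] mA c by (auto simp: D_def field_simps)
  obtain M n0 where M: "\<And>n q. n \<ge> n0 \<Longrightarrow> degree q \<le> d \<Longrightarrow> \<not> sup_norm_on n (poly q) \<le> M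
    \<Longrightarrow> real (card {t\<in>{1..n}. \<bar>poly q (real t)\<bar> \<le> D + real A}) < \<delta> * real n"
    by (rule far_polys_rarely_close[OF \<delta>, where D = "D + real A" and d = d]) blast
  have "AE \<omega> in P. \<forall>x\<in>S. eventually (\<lambda>n. (\<Sum>t\<in>{1..n}. ?F A (Z x t \<omega>)) \<le> \<eta> * real n) sequentially"
  proof (subst AE_ball_countable, simp, intro ballI eventually_sum_Z_le)
    fix x assume x: "x \<in> S"
    have "integrable P (\<lambda>\<omega>. if \<omega> \<in> {\<omega>. real A < \<bar>Z x 1 \<omega>\<bar>} then H (Z x 1 \<omega>) else 0)"
      by (rule Bochner_Integration.integrable_bound[OF H_int[OF x]]) (use H_pos in \<open>auto intro: less_imp_le\<close>)
    then show "integrable P (\<lambda>\<omega>. ?F A (Z x 1 \<omega>))" by simp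
    show "2 * expectation (\<lambda>\<omega>. ?F A (Z x 1 \<omega>)) < \<eta>" using A x by force
  qed (auto intro: less_imp_le[OF H_pos])
  with AE_X_in have "AE \<omega> in P. eventually (\<lambda>n. \<forall>\<theta>\<in>Theta K d \<sigma> \<Gamma>.
      (\<forall>\<theta>'\<in>Theta K d \<sigma> \<Gamma>. likelihood \<theta>' n (obs \<omega>) \<le> likelihood \<theta> n (obs \<omega>))
    \<longrightarrow> (\<forall>xs\<in>S. \<exists>x\<in>{1..Kp \<theta>}. sup_norm_on n (poly (Tp \<theta>s xs - Tp \<theta> x)) \<le> M1)
    \<longrightarrow> (\<forall>x\<in>{1..Kp \<theta>}. \<exists>xs\<in>S. sup_norm_on n (poly (Tp \<theta>s xs - Tp \<theta> x)) \<le> max M1 M)) sequentially"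
  proof eventually_elim
    case (elim \<omega>)
    have X: "X t \<omega> \<in> S" if "t \<ge> 1" for t using elim(1) that by blast
    have "eventually (\<lambda>n. \<forall>x\<in>S. (\<Sum>t\<in>{1..n}. ?F A (Z x t \<omega>)) \<le> \<eta> * real n) sequentially"
      using elim(2) by (intro eventually_ball_finite) auto
    \<comment> \<open>\<open>ln K\<close> is the price of the new initial law; the extra
      \<open>\<kappa>\<close> is there because \<open>n\<close> observations have only
      \<open>n - 1\<close> transitions.\<close>
    moreover have "eventually (\<lambda>n. ln (real K) + \<kappa> < \<kappa> / 4 * real n) sequentially"
      using \<kappa> by real_asymp
    ultimately show ?case using eventually_ge_at_top[of "max 1 n0"]
    proof eventually_elim
      case (elim n)
      obtain l where l: "n = Suc l" using elim by (cases n) auto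
      show ?case
      proof (intro ballI impI, rule ccontr)
        fix \<theta> x
        assume \<theta>: "\<theta> \<in> Theta K d \<sigma> \<Gamma>"
          and maximal: "\<forall>\<theta>'\<in>Theta K d \<sigma> \<Gamma>. likelihood \<theta>' n (obs \<omega>) \<le> likelihood \<theta> n (obs \<omega>)"
          and covered: "\<forall>xs\<in>S. \<exists>x\<in>{1..Kp \<theta>}. sup_norm_on n (poly (Tp \<theta>s xs - Tp \<theta> x)) \<le> M1"
          and x: "x \<in> {1..Kp \<theta>}"
          and far: "\<not> (\<exists>xs\<in>S. sup_norm_on n (poly (Tp \<theta>s xs - Tp \<theta> x)) \<le> max M1 M)"
        let ?e = "emission \<theta> (obs \<omega>)"
        obtain h where h: "\<And>xs. xs \<in> S \<Longrightarrow> h xs \<in> {1..Kp \<theta>}"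
            "\<And>xs. xs \<in> S \<Longrightarrow> sup_norm_on n (poly (Tp \<theta>s xs - Tp \<theta> (h xs))) \<le> M1"
          using bchoice[of S "\<lambda>xs x. x \<in> {1..Kp \<theta>} \<and> sup_norm_on n (poly (Tp \<theta>s xs - Tp \<theta> x)) \<le> M1"] covered
          by blast
        \<comment> \<open>The bound \<open>max M1 M\<close> in the claim guarantees that a component
          within \<open>M1\<close> of a true trend is not \<open>x\<close>; in particular another
          component remains after the deletion.\<close>
        have hx: "h xs \<in> {1..Kp \<theta>} - {x}" if "xs \<in> S" for xs
        proof -
          have "h xs \<noteq> x"
          proof
            assume "h xs = x"
            then have "sup_norm_on n (poly (Tp \<theta>s xs - Tp \<theta> x)) \<le> max M1 M" using h(2)[OF that] by simp
            with far that show False by blast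
          qed
          with h(1)[OF that] show ?thesis by blast
        qed
        \<comment> \<open>The deletion needs a substitute at every index, but \<open>X 0\<close> is
          unconstrained; state 1 is a dummy there.\<close>
        define x' where "x' t = h (if t = 0 then 1 else X t \<omega>)" for t
        have x': "x' t \<in> {1..Kp \<theta>} - {x}" for t
          unfolding x'_def by (rule hx) (use X[of t] k in auto)
        define r where "r t = ?e t x / ?e t (x' t)" for t
        define z where "z t = Z (X t \<omega>) t \<omega>" for t
        define close where "close xs = {t\<in>{1..n}. \<bar>poly (Tp \<theta>s xs - Tp \<theta> x) (real t)\<bar> \<le> D + real A}" for xs
        define bad where "bad = (\<Union>xs\<in>S. close xs)"
        have e_x': "m (M1 + \<bar>z t\<bar>) \<le> ?e t (x' t)" if t: "t \<in> {1..n}" for t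
        proof (rule emission_ge[OF \<theta>])
          have "\<bar>poly (Tp \<theta>s (X t \<omega>) - Tp \<theta> (h (X t \<omega>))) (real t)\<bar> \<le> M1"
            using h(2)[OF X] abs_poly_le_sup_norm_on[of "real t" n] t by (smt (verit) atLeastAtMost_iff of_nat_0_le_iff of_nat_le_iff)
          then show "\<bar>obs \<omega> t - poly (Tp \<theta> (x' t)) (real t)\<bar> \<le> M1 + \<bar>z t\<bar>"
            using t unfolding obs_minus_trend x'_def z_def by auto
        qed (use x' in blast)
        have e_x: "?e t x \<le> G" for t using emission_le[OF \<theta> x, of 0 "obs \<omega>" t] G by simp
        have e_pos: "0 < ?e t x" "0 < ?e t (x' t)" for t using emission_pos[OF \<theta>] x x' by auto
        have m_z: "0 < m (M1 + \<bar>z t\<bar>)" for t using M1 by (intro m_pos) auto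
        have ratio: "1 + c * r t \<le> exp (H (z t))" if t: "t \<in> {1..n}" for t
        proof -
          have "r t \<le> G / m (M1 + \<bar>z t\<bar>)"
            unfolding r_def using e_x e_x'[OF t] m_z e_pos G by (intro frac_le) auto
          then have "1 + c * r t \<le> 1 + c * (G / m (M1 + \<bar>z t\<bar>))"
            using c by (intro add_left_mono mult_left_mono) auto
          then show ?thesis using H_exp by (rule order_trans)
        qed
        have ratio_good: "1 + c * r t \<le> exp (\<kappa> / 4)" if t: "t \<in> {1..n}" "t \<notin> bad" "\<bar>z t\<bar> \<le> real A" for t
        proof -
          have "D + real A < \<bar>poly (Tp \<theta>s (X t \<omega>) - Tp \<theta> x) (real t)\<bar>"
            using t X[of t] by (auto simp: bad_def close_def not_le)
          then have "D \<le> \<bar>obs \<omega> t - poly (Tp \<theta> x) (real t)\<bar>"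
            using t(3) unfolding obs_minus_trend z_def by auto
          then have gD: "?e t x \<le> g D" by (intro emission_le[OF \<theta> x D(1)])
          have "m (M1 + real A) \<le> m (M1 + \<bar>z t\<bar>)" using M1 t by (intro m_antimono) auto
          then have "m (M1 + real A) \<le> ?e t (x' t)" using e_x'[OF t(1)] by simp
          then have "r t \<le> g D / m (M1 + real A)"
            unfolding r_def using gD e_pos[of t] mA by (intro frac_le) auto
          then have "1 + c * r t \<le> 1 + c * (g D / m (M1 + real A))"
            using c by (intro add_left_mono mult_left_mono) auto
          then show ?thesis using D(2) by (rule order_trans)
        qed
        \<comment> \<open>Three costs, each at most \<open>\<kappa> / 4\<close> per time on average:
          ordinary times, times near a true trend, large noise.\<close>
        define w where "w t = \<kappa> / 4 + (if t \<in> bad then B else 0) + ?F A (z t)" for t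
        have w: "1 + c * r t \<le> exp (w t)" if t: "t \<in> {1..n}" for t
        proof (cases "real A < \<bar>z t\<bar>")
          case True
          then have "H (z t) \<le> w t" using \<kappa> B by (auto simp: w_def)
          then show ?thesis using ratio[OF t] by (meson exp_le_cancel_iff order_trans)
        next
          case False
          show ?thesis
          proof (cases "t \<in> bad")
            case True
            have "H (z t) \<le> B" unfolding B_def using False by (intro H_mono) auto
            then have "H (z t) \<le> w t" using True False \<kappa> by (simp add: w_def)
            then show ?thesis using ratio[OF t] by (meson exp_le_cancel_iff order_trans)
          next
            case nb: False
            then show ?thesis using ratio_good[OF t nb] False by (simp add: w_def)
          qed
        qed
        have w_sum: "(\<Sum>t\<in>{1..n}. w t) \<le> 3 * \<kappa> / 4 * real n"
        proof -
          have fin: "finite (close xs)" for xs by (simp add: close_def)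
          have "real (card (close xs)) \<le> \<delta> * real n" if xs: "xs \<in> S" for xs
          proof -
            have "\<not> sup_norm_on n (poly (Tp \<theta>s xs - Tp \<theta> x)) \<le> M" using far xs by force
            moreover have "degree (Tp \<theta>s xs - Tp \<theta> x) \<le> d"
              by (intro degree_diff_le ThetaD(8)[OF \<theta>s xs] ThetaD(8)[OF \<theta> x])
            ultimately show ?thesis unfolding close_def using M[of n] elim by fastforce
          qed
          then have "(\<Sum>xs\<in>S. real (card (close xs))) \<le> real (Kp \<theta>s) * (\<delta> * real n)"
            using sum_bounded_above[of S "\<lambda>xs. real (card (close xs))"] by simp
          moreover have "real (card bad) \<le> (\<Sum>xs\<in>S. real (card (close xs)))"
            unfolding bad_def of_nat_sum[symmetric] of_nat_le_iff by (intro card_UN_le) auto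
          ultimately have "real (card bad) * B \<le> real (Kp \<theta>s) * (\<delta> * real n) * B" using B by (intro mult_right_mono) auto
          also have "\<dots> = \<kappa> / 4 * real n" using B k by (simp add: \<delta>_def \<eta>_def)
          finally have 1: "real (card bad) * B \<le> \<kappa> / 4 * real n" .
          have "bad \<subseteq> {1..n}" by (auto simp: bad_def close_def)
          then have 2: "(\<Sum>t\<in>{1..n}. if t \<in> bad then B else 0) = real (card bad) * B"
            by (simp add: sum.If_cases Int_absorb1)
          have "(\<Sum>t\<in>{1..n}. ?F A (z t)) \<le> (\<Sum>xs\<in>S. \<Sum>t\<in>{1..n}. ?F A (Z xs t \<omega>))"
            unfolding z_def by (rule sum_selected_le) (use X in \<open>auto intro: less_imp_le[OF H_pos]\<close>)
          also have "\<dots> \<le> (\<Sum>xs\<in>S. \<eta> * real n)" using elim(1) by (intro sum_mono) blast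
          also have "\<dots> = \<kappa> / 4 * real n" using k by (simp add: \<eta>_def)
          finally have "(\<Sum>t\<in>{1..n}. ?F A (z t)) \<le> \<kappa> / 4 * real n" .
          with 1 2 show ?thesis by (simp add: w_def sum.distrib)
        qed
        have "(\<Prod>t\<in>{1..n}. 1 + c * r t) \<le> (\<Prod>t\<in>{1..n}. exp (w t))"
        proof (intro prod_mono conjI)
          fix t assume t: "t \<in> {1..n}"
          have "0 \<le> c * r t" using c e_pos[of t] by (simp add: r_def)
          then show "0 \<le> 1 + c * r t" by simp
          show "1 + c * r t \<le> exp (w t)" by (rule w[OF t])
        qed
        also have "\<dots> = exp (\<Sum>t\<in>{1..n}. w t)" by (simp add: exp_sum)
        also have "\<dots> \<le> exp (3 * \<kappa> / 4 * real n)" unfolding exp_le_cancel_iff by (rule w_sum)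
        finally have prod: "(\<Prod>t\<in>{1..n}. 1 + c * r t) \<le> exp (3 * \<kappa> / 4 * real n)" .
        obtain \<theta>' where \<theta>': "\<theta>' \<in> Theta K d \<sigma> \<Gamma>"
            and le: "likelihood \<theta> n (obs \<omega>) \<le> real K * (1 - \<sigma>) ^ l * (\<Prod>t\<in>{1..n}. 1 + c * r t) * likelihood \<theta>' n (obs \<omega>)"
          using ex_delete_component[OF \<theta> \<sigma> x, of x' l "obs \<omega>", OF x', folded l c_def r_def] by (elim bexE)
        note pos = likelihood_pos[OF \<theta>' \<sigma>(1), of n "obs \<omega>"]
        have "likelihood \<theta>' n (obs \<omega>) \<le> likelihood \<theta> n (obs \<omega>)" using maximal \<theta>' by blast
        also note le
        also have "real K * (1 - \<sigma>) ^ l * (\<Prod>t\<in>{1..n}. 1 + c * r t) * likelihood \<theta>' n (obs \<omega>)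
            \<le> real K * (1 - \<sigma>) ^ l * exp (3 * \<kappa> / 4 * real n) * likelihood \<theta>' n (obs \<omega>)"
          using prod \<sigma> pos elim by (intro mult_right_mono mult_left_mono) auto
        also have "real K * (1 - \<sigma>) ^ l * exp (3 * \<kappa> / 4 * real n)
            = exp (ln (real K) - \<kappa> * real l + 3 * \<kappa> / 4 * real n)"
        proof -
          have "(1 - \<sigma>) ^ l = exp (- \<kappa> * real l)" using \<sigma> by (simp add: \<kappa>_def mult.commute exp_of_nat_mult)
          moreover have "exp (ln (real K)) = real K" using k by simp
          moreover have "exp (ln (real K) - \<kappa> * real l + 3 * \<kappa> / 4 * real n)
              = exp (ln (real K)) * exp (- \<kappa> * real l) * exp (3 * \<kappa> / 4 * real n)"
            unfolding exp_add[symmetric] by simp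
          ultimately show ?thesis by metis
        qed
        finally have "1 \<le> exp (ln (real K) - \<kappa> * real l + 3 * \<kappa> / 4 * real n)"
          using pos elim by simp
        then have "0 \<le> ln (real K) - \<kappa> * real l + 3 * \<kappa> / 4 * real n" by simp
        moreover have "real l = real n - 1" by (simp add: l)
        ultimately show False using elim(2) by (simp add: algebra_simps)
      qed
    qed
  qed
  then show ?thesis using M1 by (intro exI[of _ "max M1 M"]) auto
qed

end

theorem theorem4:
  fixes K d :: nat and \<sigma> :: real and \<Gamma> :: "(real \<Rightarrow> real) set"
    and \<theta>s :: hmm_param
    and P :: "'w measure"
    and X :: "nat \<Rightarrow> 'w \<Rightarrow> nat" and Z :: "nat \<Rightarrow> nat \<Rightarrow> 'w \<Rightarrow> real"
    and g m :: "real \<Rightarrow> real"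
    and \<theta>hat :: "nat \<Rightarrow> 'w \<Rightarrow> hmm_param"
  defines "Y \<equiv> (\<lambda>\<omega> t. Z (X t \<omega>) t \<omega> + poly (Tp \<theta>s (X t \<omega>)) (real t))"
    and "Zmax \<equiv> (\<lambda>t \<omega>. Max ((\<lambda>x. \<bar>Z x t \<omega>\<bar>) ` {1..Kp \<theta>s}))"
  assumes K: "1 \<le> K" and d: "1 \<le> d" and \<sigma>: "0 < \<sigma>" "\<sigma> < 1"
    and \<Gamma>_dens: "\<forall>\<gamma>\<in>\<Gamma>. is_density \<gamma>"
    and \<Gamma>_compact: "compact \<Gamma>"
    and \<theta>s: "\<theta>s \<in> Theta K d \<sigma> \<Gamma>"
    \<comment> \<open>data-generating process under P*\<close>
    and P: "prob_space P"
    and X_meas: "\<forall>t. X t \<in> measurable P (count_space UNIV)"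
    and Z_meas: "\<forall>x t. Z x t \<in> borel_measurable P"
    and joint_law: "\<forall>n \<ge> 1. \<forall>xs \<in> PiE {1..n} (\<lambda>_. {1..Kp \<theta>s}).
       \<forall>B. (\<forall>x t. B x t \<in> sets borel) \<longrightarrow>
         emeasure P {\<omega> \<in> space P. (\<forall>t\<in>{1..n}. X t \<omega> = xs t)
                                 \<and> (\<forall>x\<in>{1..Kp \<theta>s}. \<forall>t\<in>{1..n}. Z x t \<omega> \<in> B x t)}
         = ennreal (pip \<theta>s (xs 1) * (\<Prod>t\<in>{2..n}. Qp \<theta>s (xs (t - 1)) (xs t)))
           * (\<Prod>x\<in>{1..Kp \<theta>s}. \<Prod>t\<in>{1..n}.
                emeasure (density lborel (\<lambda>z. ennreal (gam \<theta>s x z))) (B x t))"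
    \<comment> \<open>(Amax)\<close>
    and Amax: "(\<forall>z\<ge>0. 0 \<le> g z) \<and> antimono_on {0..} g \<and> (g \<longlongrightarrow> 0) at_top
               \<and> (\<forall>\<gamma>\<in>\<Gamma>. \<forall>z. \<gamma> z \<le> g \<bar>z\<bar>)"
    \<comment> \<open>(Amin)\<close>
    and Amin: "(\<forall>z\<ge>0. 0 < m z) \<and> antimono_on {0..} m
               \<and> (\<forall>\<gamma>\<in>\<Gamma>. \<forall>z. m \<bar>z\<bar> \<le> \<gamma> z)"
    \<comment> \<open>(Aint)\<close>
    and Aint: "\<forall>c>0. integrable P (\<lambda>\<omega>. ln (m (c + Zmax 1 \<omega>)))"
    \<comment> \<open>maximum likelihood estimator\<close>
    and mle: "\<forall>n \<ge> 1. \<forall>\<omega> \<in> space P. \<theta>hat n \<omega> \<in> Theta K d \<sigma> \<Gamma>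
               \<and> (\<forall>\<theta> \<in> Theta K d \<sigma> \<Gamma>. loglik \<theta> n (Y \<omega>) / real n \<le> loglik (\<theta>hat n \<omega>) n (Y \<omega>) / real n)"
  shows "\<exists>M>0. AE \<omega> in P. \<exists>nloc. \<forall>n \<ge> nloc.
           \<theta>hat n \<omega> \<in> Theta_OK (Kp \<theta>s) (Tp \<theta>s) n M (Theta K d \<sigma> \<Gamma>)"
proof -
  have env: "density_envelope \<Gamma> g m"
    by standard (use Amax Amin in \<open>auto simp: monotone_on_def\<close>)
  have data: "hmm_data P X Z (Kp \<theta>s) (pip \<theta>s) (Qp \<theta>s) \<sigma> (gam \<theta>s)"
  proof (intro hmm_data.intro hmm_data_axioms.intro P)
    show "prob_vec (Kp \<theta>s) (pip \<theta>s)" "stoch_mat_lb \<sigma> (Kp \<theta>s) (Qp \<theta>s)"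
      using \<theta>s by (auto simp: Theta_def)
    show "is_density (gam \<theta>s x)" if "x \<in> {1..Kp \<theta>s}" for x
      using \<Gamma>_dens ThetaD(7)[OF \<theta>s that] by blast
  qed (use \<sigma> X_meas Z_meas joint_law in blast)+
  interpret env: density_envelope \<Gamma> g m by (rule env)
  interpret data: hmm_data P X Z "Kp \<theta>s" "pip \<theta>s" "Qp \<theta>s" \<sigma> "gam \<theta>s" by (rule data)
  \<comment> \<open>As \<open>m\<close> decreases, \<open>- ln m\<close> at one component is at most
    \<open>- ln m\<close> at the maximum, so the negative part of the logarithm inherits
    integrability.\<close>
  have log_int: "integrable P (\<lambda>\<omega>. max 0 (- ln (m (c + \<bar>Z x 1 \<omega>\<bar>))))"
    if x: "x \<in> {1..Kp \<theta>s}" and c: "0 < c" for x c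
  proof (rule Bochner_Integration.integrable_bound)
    show "integrable P (\<lambda>\<omega>. ln (m (c + Zmax 1 \<omega>)))" using Aint c by blast
    note [measurable] = env.measurable_m_abs[OF less_imp_le[OF c]]
    show "(\<lambda>\<omega>. max 0 (- ln (m (c + \<bar>Z x 1 \<omega>\<bar>)))) \<in> borel_measurable P" by measurable
    show "AE \<omega> in P. norm (max 0 (- ln (m (c + \<bar>Z x 1 \<omega>\<bar>)))) \<le> norm (ln (m (c + Zmax 1 \<omega>)))"
    proof (intro AE_I2)
      fix \<omega>
      have le: "\<bar>Z x 1 \<omega>\<bar> \<le> Zmax 1 \<omega>" unfolding Zmax_def using x by (intro Max_ge) auto
      then have "m (c + Zmax 1 \<omega>) \<le> m (c + \<bar>Z x 1 \<omega>\<bar>)" using c by (intro env.m_antimono) auto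
      moreover have "0 < m (c + Zmax 1 \<omega>)" using c le by (intro env.m_pos) auto
      ultimately have "ln (m (c + Zmax 1 \<omega>)) \<le> ln (m (c + \<bar>Z x 1 \<omega>\<bar>))" by simp
      then show "norm (max 0 (- ln (m (c + \<bar>Z x 1 \<omega>\<bar>)))) \<le> norm (ln (m (c + Zmax 1 \<omega>)))" by auto
    qed
  qed
  interpret hmm_trend P X Z \<theta>s \<sigma> \<Gamma> g m K d
    by (intro hmm_trend.intro hmm_trend_axioms.intro data env \<theta>s log_int)
  have Y_eq: "Y \<omega> = obs \<omega>" for \<omega>
    by (simp add: Y_def obs_def fun_eq_iff)
  obtain C0 where true_ge: "AE \<omega> in P. eventually (\<lambda>n. - C0 * real n \<le> ln (likelihood \<theta>s n (obs \<omega>))) sequentially"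
    using ex_loglik_true_ge by blast
  obtain M1 where M1: "0 < M1" and covered: "AE \<omega> in P. eventually (\<lambda>n. \<forall>\<theta>\<in>Theta K d \<sigma> \<Gamma>.
      - C0 * real n \<le> ln (likelihood \<theta> n (obs \<omega>))
    \<longrightarrow> (\<forall>xs\<in>{1..Kp \<theta>s}. \<exists>x\<in>{1..Kp \<theta>}. sup_norm_on n (poly (Tp \<theta>s xs - Tp \<theta> x)) \<le> M1)) sequentially"
    using ex_true_components_covered[of C0] by blast
  obtain M2 where no_far: "AE \<omega> in P. eventually (\<lambda>n. \<forall>\<theta>\<in>Theta K d \<sigma> \<Gamma>.
      (\<forall>\<theta>'\<in>Theta K d \<sigma> \<Gamma>. likelihood \<theta>' n (obs \<omega>) \<le> likelihood \<theta> n (obs \<omega>))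
    \<longrightarrow> (\<forall>xs\<in>{1..Kp \<theta>s}. \<exists>x\<in>{1..Kp \<theta>}. sup_norm_on n (poly (Tp \<theta>s xs - Tp \<theta> x)) \<le> M1)
    \<longrightarrow> (\<forall>x\<in>{1..Kp \<theta>}. \<exists>xs\<in>{1..Kp \<theta>s}. sup_norm_on n (poly (Tp \<theta>s xs - Tp \<theta> x)) \<le> M2)) sequentially"
    using ex_no_far_component[OF M1] by blast
  have poly_diff_fun: "(\<lambda>s. poly a s - poly b s) = poly (a - b)" for a b :: "real poly"
    by (simp add: fun_eq_iff)
  have "AE \<omega> in P. eventually (\<lambda>n. \<theta>hat n \<omega> \<in> Theta_OK (Kp \<theta>s) (Tp \<theta>s) n (max M1 M2) (Theta K d \<sigma> \<Gamma>)) sequentially"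
    using AE_space true_ge covered no_far
  proof eventually_elim
    case (elim \<omega>)
    from elim(2-4) eventually_ge_at_top[of 1] show ?case
    proof eventually_elim
      case (elim n)
      have n: "1 \<le> n" by (fact elim(4))
      have hat: "\<theta>hat n \<omega> \<in> Theta K d \<sigma> \<Gamma>" using mle n \<open>\<omega> \<in> space P\<close> by blast
      have max_lik: "likelihood \<theta> n (obs \<omega>) \<le> likelihood (\<theta>hat n \<omega>) n (obs \<omega>)"
        if \<theta>: "\<theta> \<in> Theta K d \<sigma> \<Gamma>" for \<theta>
      proof -
        have "loglik \<theta> n (Y \<omega>) / real n \<le> loglik (\<theta>hat n \<omega>) n (Y \<omega>) / real n"
          using mle n \<open>\<omega> \<in> space P\<close> \<theta> by blast
        then have "loglik \<theta> n (obs \<omega>) \<le> loglik (\<theta>hat n \<omega>) n (obs \<omega>)"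
          using n by (simp add: Y_eq divide_le_cancel)
        then show ?thesis
          using env.likelihood_pos[OF \<theta> \<sigma>(1) n] env.likelihood_pos[OF hat \<sigma>(1) n] by (simp add: loglik_eq)
      qed
      have "- C0 * real n \<le> ln (likelihood \<theta>s n (obs \<omega>))" by (fact elim(1))
      also have "\<dots> \<le> ln (likelihood (\<theta>hat n \<omega>) n (obs \<omega>))"
        using max_lik[OF \<theta>s] env.likelihood_pos[OF \<theta>s \<sigma>(1) n] env.likelihood_pos[OF hat \<sigma>(1) n] by simp
      finally have 1: "\<forall>xs\<in>{1..Kp \<theta>s}. \<exists>x\<in>{1..Kp (\<theta>hat n \<omega>)}.
          sup_norm_on n (poly (Tp \<theta>s xs - Tp (\<theta>hat n \<omega>) x)) \<le> M1"
        using elim(2) hat by blast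
      have 2: "\<forall>x\<in>{1..Kp (\<theta>hat n \<omega>)}. \<exists>xs\<in>{1..Kp \<theta>s}.
          sup_norm_on n (poly (Tp \<theta>s xs - Tp (\<theta>hat n \<omega>) x)) \<le> M2"
        using elim(3) hat max_lik 1 by blast
      show ?case
        unfolding Theta_OK_def poly_diff_fun mem_Collect_eq le_max_iff_disj using hat 1 2 by blast
    qed
  qed
  then have "AE \<omega> in P. \<exists>nloc. \<forall>n\<ge>nloc. \<theta>hat n \<omega> \<in> Theta_OK (Kp \<theta>s) (Tp \<theta>s) n (max M1 M2) (Theta K d \<sigma> \<Gamma>)"
    by (simp only: eventually_sequentially)
  then show ?thesis using M1 by (intro exI[of _ "max M1 M2"]) auto
qed

end
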